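(* Let $a_1\ne a_2$ be non-negative integers, $\Omega=[a_1,a_1+1)\cup[a_2,a_2+1)$, and let $\mathbf N=(N,N)$ be simple for $\Omega$. Let $T:\Omega\to\Omega$ be the associated map, $\mathcal B_\Omega$ the Borel $\sigma$-algebra of $\Omega$, and $\mu_T$ the unique $T$-invariant ergodic Borel probability measure on $\Omega$ that is absolutely continuous with respect to Lebesgue measure. Then for all $A\in\mathcal B_\Omega$, $$\mu_T(A)=C\int_A\left(\frac{a_2+1}{N+(a_2+1)x}-\frac{a_2}{N+a_2x}\right)\mathbf 1_{[a_1,a_1+1)}(x)+\left(\frac{a_1+1}{N+(a_1+1)x}-\frac{a_1}{N+a_1x}\right)\mathbf 1_{[a_2,a_2+1)}(x)\,dx,$$ where $$C^{-1}=2\ln\left[1+\frac{N}{(N+a_1(a_2+1))(N+a_2(a_1+1))}\right].$$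
   Context: Write $I_1=[a_1,a_1+1)$, $I_2=[a_2,a_2+1)$. The pair $\mathbf N=(N,N)$, with $N$ a positive integer, is simple for $\Omega$ if (i) it is allowable: $\lfloor N/x\rfloor-a_2>0$ for all $x\in I_1$, $x\ne0$, and $\lfloor N/x\rfloor-a_1>0$ for all $x\in I_2$, $x\neq0$; and (ii) for each $i\in\{1,2\}$ with $a_i\ne0$, both $a_i\mid N$ and $a_i+1\mid N$. The map $T$ is $$T(x)=\frac Nx-\left\lfloor\frac Nx\right\rfloor+a_2\ (x\in I_1,\ x\ne0),\qquad T(x)=\frac Nx-\left\lfloor\frac Nx\right\rfloor+a_1\ (x\in I_2,\ x\neq0),$$ and $T(0)=0$ if $0\in\Omega$. *)

theory Defs
  imports "HOL-Probability.Probability"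
begin

definition unit_interval_at :: "nat \<Rightarrow> real set" where
  "unit_interval_at a = {real a ..< real a + 1}"

definition Omega :: "nat \<Rightarrow> nat \<Rightarrow> real set" where
  "Omega a1 a2 = unit_interval_at a1 \<union> unit_interval_at a2"

definition allowable :: "nat \<Rightarrow> nat \<Rightarrow> nat \<Rightarrow> bool" where
  "allowable a1 a2 N \<longleftrightarrow>
     (\<forall>x\<in>unit_interval_at a1. x \<noteq> 0 \<longrightarrow> \<lfloor>real N / x\<rfloor> - int a2 > 0) \<and>
     (\<forall>x\<in>unit_interval_at a2. x \<noteq> 0 \<longrightarrow> \<lfloor>real N / x\<rfloor> - int a1 > 0)"

definition simple_for :: "nat \<Rightarrow> nat \<Rightarrow> nat \<Rightarrow> bool" where
  "simple_for a1 a2 N \<longleftrightarrow>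
     N > 0 \<and> allowable a1 a2 N \<and>
     (\<forall>a\<in>{a1, a2}. a \<noteq> 0 \<longrightarrow> a dvd N \<and> a + 1 dvd N)"

text \<open>Only the values on \<open>Omega a1 a2\<close> matter. For distinct \<open>a1\<close> and \<open>a2\<close> the
  two intervals are disjoint, so the last case is the one for the second interval.\<close>

definition T_map :: "nat \<Rightarrow> nat \<Rightarrow> nat \<Rightarrow> real \<Rightarrow> real" where
  "T_map a1 a2 N x =
     (if x = 0 then 0
      else if x \<in> unit_interval_at a1 then real N / x - of_int \<lfloor>real N / x\<rfloor> + real a2
      else real N / x - of_int \<lfloor>real N / x\<rfloor> + real a1)"

definition borel_Omega :: "nat \<Rightarrow> nat \<Rightarrow> real measure" where
  "borel_Omega a1 a2 = restrict_space borel (Omega a1 a2)"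

definition invariant_measure :: "('a \<Rightarrow> 'a) \<Rightarrow> 'a measure \<Rightarrow> bool" where
  "invariant_measure T \<mu> \<longleftrightarrow> T \<in> measurable \<mu> \<mu> \<and> distr \<mu> \<mu> T = \<mu>"

definition ergodic_measure :: "('a \<Rightarrow> 'a) \<Rightarrow> 'a measure \<Rightarrow> bool" where
  "ergodic_measure T \<mu> \<longleftrightarrow>
     (\<forall>A\<in>sets \<mu>. T -` A \<inter> space \<mu> = A \<longrightarrow> measure \<mu> A = 0 \<or> measure \<mu> A = 1)"

text \<open>Invariant ergodic Borel probability measures on \<open>Omega a1 a2\<close> that are
  absolutely continuous with respect to Lebesgue measure. In the library,
  \<open>absolutely_continuous M \<mu>\<close> says that \<open>\<mu>\<close> is absolutely continuous with respect to \<open>M\<close>.\<close>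

definition ergodic_acim :: "nat \<Rightarrow> nat \<Rightarrow> nat \<Rightarrow> real measure \<Rightarrow> bool" where
  "ergodic_acim a1 a2 N \<mu> \<longleftrightarrow>
     sets \<mu> = sets (borel_Omega a1 a2) \<and>
     prob_space \<mu> \<and>
     invariant_measure (T_map a1 a2 N) \<mu> \<and>
     ergodic_measure (T_map a1 a2 N) \<mu> \<and>
     absolutely_continuous (restrict_space lborel (Omega a1 a2)) \<mu>"

definition mu_T :: "nat \<Rightarrow> nat \<Rightarrow> nat \<Rightarrow> real measure" where
  "mu_T a1 a2 N = (THE \<mu>. ergodic_acim a1 a2 N \<mu>)"

end

theory Submission
  imports Defs "HOL-Real_Asymp.Real_Asymp"
begin

text \<open>
  Invariance of the stated density is a telescoping sum over the inverse branches
  \<open>y \<mapsto> N / (k + y)\<close> of \<open>T\<close>, and the constant \<open>C\<close> comes from integrating the density explicitly.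

  For ergodicity, measure distances by \<open>d x y = \<bar>ln (x + 1/2) - ln (y + 1/2)\<bar>\<close>. Since allowability
  forces \<open>k \<ge> 1\<close>, every inverse branch contracts \<open>d\<close> by a uniform factor \<open>\<beta> < 1\<close>, even when \<open>T\<close> is
  not expanding for the Euclidean metric, and the logarithm of its derivative is 2-Lipschitz. Hence
  the transfer operator maps functions whose logarithm is \<open>K\<close>-Lipschitz to functions whose logarithm
  is \<open>(\<beta> K + 2)\<close>-Lipschitz. For an invariant set \<open>A\<close> of positive measure this gives, after
  sufficiently many iterations, \<open>\<integral>\<^sub>A f \<ge> \<delta> \<integral> f\<close> with \<open>\<delta> > 0\<close> independent of \<open>f\<close>. Applying this to
  \<open>f = exp (- n dist (x, S))\<close> for closed \<open>S\<close> disjoint from \<open>A\<close> and letting \<open>n \<rightarrow> \<infinity>\<close> shows that \<open>S\<close> is null,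
  so that \<open>A\<close> has full measure.
\<close>

subsection \<open>Transfer operator\<close>

text \<open>Working on open intervals discards only null sets and avoids two exceptions: the fixed
  point 0, and a left endpoint a > 0, whose digit N / a lies outside
  \<open>digits a N\<close>.\<close>

definition open_unit :: "nat \<Rightarrow> real set" where
  "open_unit a = {real a <..< real a + 1}"

text \<open>Under the divisibility conditions these are the values of the floor of N / x on the open
  interval at \<open>a\<close>. Writing N / (a + 1) \<le> m < N / a without division covers a = 0,
  where the set is infinite.\<close>

definition digits :: "nat \<Rightarrow> nat \<Rightarrow> nat set" where
  "digits a N = {m. N \<le> m * (a + 1) \<and> m * a < N}"

text \<open>The Perron-Frobenius operator from the interval at \<open>a\<close> to the one at
  \<open>b\<close>: solving y = N / x - m + b for x gives the inverse branch, and the weight is the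
  modulus of its derivative. Values in \<open>ennreal\<close> make the series meaningful without a
  summability condition.\<close>

definition transfer_op :: "nat \<Rightarrow> nat \<Rightarrow> nat \<Rightarrow> (real \<Rightarrow> ennreal) \<Rightarrow> real \<Rightarrow> ennreal" where
  "transfer_op a b N f y =
     (\<Sum>m. (if m \<in> digits a N
        then ennreal (real N / (real m - real b + y)\<^sup>2) * f (real N / (real m - real b + y)) else 0))"

lemma transfer_op_measurable [measurable]:
  assumes [measurable]: "f \<in> borel_measurable borel"
  shows "transfer_op a b N f \<in> borel_measurable borel"
  unfolding transfer_op_def[abs_def] by measurable

text \<open>Change of variables on a single cell: for x > 0 and N > 0, the floor of N / x is m
  precisely on the half-open interval in the indicator.\<close>

lemma nn_integral_inverse_branch:
  fixes f g :: "real \<Rightarrow> ennreal" and m b N :: nat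
  assumes [measurable]: "f \<in> borel_measurable borel" "g \<in> borel_measurable borel"
    and m: "0 < m"
  shows "(\<integral>\<^sup>+x. g (real N / x - real m + real b) * f x
            * indicator {real N / (real m + 1)<..real N / real m} x \<partial>lborel)
       = (\<integral>\<^sup>+y. g y * (ennreal (real N / (real m - real b + y)\<^sup>2) * f (real N / (real m - real b + y)))
            * indicator (open_unit b) y \<partial>lborel)" (is "?L = ?R")
proof (cases "N = 0")
  case True
  then show ?thesis by simp
next
  case False
  \<comment> \<open>The inverse branch decreases in y, while the substitution rule wants a
    nonnegative derivative. Hence the parameter s = -y, which is reflected back afterwards.\<close>
  define \<phi> where "\<phi> s = real N / (real m - real b - s)" for s :: real
  define \<phi>' where "\<phi>' s = real N / (real m - real b - s)\<^sup>2" for s :: real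
  define F where "F x = g (real N / x - real m + real b) * f x" for x
  have [measurable]: "F \<in> borel_measurable borel" "\<phi> \<in> borel_measurable borel" "\<phi>' \<in> borel_measurable borel"
    unfolding F_def[abs_def] \<phi>_def[abs_def] \<phi>'_def[abs_def] by measurable
  have endp: "\<phi> (- real b - 1) = real N / (real m + 1)" "\<phi> (- real b) = real N / real m"
    by (simp_all add: \<phi>_def add.commute)
  have pos: "real m - real b - s > 0" if "s \<in> {- real b - 1 .. - real b}" for s
    using that m by auto
  have "?L = (\<integral>\<^sup>+x. F x * indicator {\<phi> (- real b - 1)..\<phi> (- real b)} x \<partial>lborel)"
    unfolding endp F_def
    by (intro nn_integral_cong_AE)
       (use AE_lborel_singleton[of "real N / (real m + 1)"] in
         \<open>eventually_elim, auto simp: indicator_def\<close>)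
  also have "\<dots> = (\<integral>\<^sup>+s. F (\<phi> s) * \<phi>' s * indicator {- real b - 1 .. - real b} s \<partial>lborel)"
  proof (rule nn_integral_substitution_aux)
    show "(\<phi> has_real_derivative \<phi>' s) (at s)" if "s \<in> {- real b - 1 .. - real b}" for s
      using pos[OF that] unfolding \<phi>_def \<phi>'_def
      by (auto intro!: derivative_eq_intros simp: power2_eq_square)
    show "continuous_on {- real b - 1 .. - real b} \<phi>'"
      unfolding \<phi>'_def using pos by (intro continuous_intros) fastforce
  qed (auto simp: \<phi>'_def)
  also have "\<dots> = (\<integral>\<^sup>+y. F (\<phi> (0 + (-1) * y)) * \<phi>' (0 + (-1) * y)
                        * indicator {- real b - 1 .. - real b} (0 + (-1) * y) \<partial>lborel)"
    by (subst nn_integral_real_affine[where c = "-1" and t = 0]) auto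
  also have "\<dots> = ?R"
  proof (intro nn_integral_cong_AE)
    show "AE y in lborel. F (\<phi> (0 + (-1) * y)) * \<phi>' (0 + (-1) * y) * indicator {- real b - 1 .. - real b} (0 + (-1) * y)
       = g y * (ennreal (real N / (real m - real b + y)\<^sup>2) * f (real N / (real m - real b + y)))
            * indicator (open_unit b) y"
      using AE_lborel_singleton[of "real b"] AE_lborel_singleton[of "real b + 1"]
    proof eventually_elim
      case (elim y)
      show ?case
      proof (cases "y \<in> open_unit b")
        case True
        then have "real m - real b + y > 0" using m by (auto simp: open_unit_def)
        then show ?thesis using True False
          by (auto simp: open_unit_def F_def \<phi>_def \<phi>'_def indicator_def mult_ac)
      next
        case False
        then show ?thesis using elim by (auto simp: open_unit_def indicator_def)
      qed
    qed
  qed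
  finally show ?thesis .
qed

text \<open>\<open>N_ge\<close> is the form in which allowability enters: the least digit N / (a +
  1) is at least b + 1, so every denominator m - b + y is at least 1 + y.\<close>

locale branches =
  fixes a b N :: nat
  assumes N_ge: "(a + 1) * (b + 1) \<le> N"
    and a_dvd: "a \<noteq> 0 \<Longrightarrow> a dvd N"
    and Suc_a_dvd: "a + 1 dvd N"
begin

lemma N_pos: "0 < N"
  using N_ge by (metis add_is_0 gr_zeroI le_zero_eq mult_is_0 one_neq_zero)

lemma digits_gt: "m \<in> digits a N \<Longrightarrow> b + 1 \<le> m"
proof -
  assume "m \<in> digits a N"
  then have "(a + 1) * (b + 1) \<le> (a + 1) * m"
    using N_ge by (simp add: digits_def mult.commute)
  then show ?thesis by (meson add_gr_0 less_numeral_extra(1) mult_le_cancel1)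
qed

text \<open>Divisibility makes every branch full: for a > 0 the quotient N / a is an integer, so m <
  N / a improves to m + 1 \<le> N / a, and the whole cell of m lies between a and a + 1.\<close>

lemma digits_bounds:
  assumes "m \<in> digits a N"
  shows "real a \<le> real N / (real m + 1)" "real N / real m \<le> real a + 1"
proof -
  have "(m + 1) * a \<le> N"
  proof (cases "a = 0")
    case False
    obtain k where k: "N = a * k" using a_dvd[OF False] by auto
    then have "m < k" using assms by (simp add: digits_def mult.commute)
    then have "(m + 1) * a \<le> k * a" by (intro mult_le_mono1) simp
    then show ?thesis using k by (simp add: mult.commute)
  qed auto
  then have "real ((m + 1) * a) \<le> real N" by (simp only: of_nat_le_iff)
  then show "real a \<le> real N / (real m + 1)"
    by (simp add: pos_le_divide_eq algebra_simps)
  have "real N \<le> real (m * (a + 1))"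
    using assms by (simp only: of_nat_le_iff digits_def mem_Collect_eq)
  then show "real N / real m \<le> real a + 1"
    using digits_gt[OF assms] by (simp add: pos_divide_le_eq algebra_simps)
qed

text \<open>As k = N / (a + 1) is an integer, N / x \<ge> k passes to the floor. The upper condition
  follows from x > a.\<close>

lemma floor_mem_digits:
  assumes "real a < x" "x \<le> real a + 1"
  shows "nat \<lfloor>real N / x\<rfloor> \<in> digits a N"
proof -
  have x: "x > 0" using assms by simp
  obtain k where k: "N = (a + 1) * k" using Suc_a_dvd by auto
  have "real k \<le> real N / x"
    using mult_right_mono[OF assms(2), of "real k"] x unfolding k
    by (simp add: pos_le_divide_eq algebra_simps)
  then have "int k \<le> \<lfloor>real N / x\<rfloor>" by (simp add: le_floor_iff)
  then have 1: "k \<le> nat \<lfloor>real N / x\<rfloor>" by simp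
  have "nat \<lfloor>real N / x\<rfloor> * a < N"
  proof (cases "a = 0")
    case False
    have "real (nat \<lfloor>real N / x\<rfloor>) \<le> real N / x" using x by simp
    also have "\<dots> < real N / real a" using False assms N_pos by (intro divide_strict_left_mono) auto
    finally show ?thesis using False by (simp add: field_simps flip: of_nat_mult)
  qed (use N_pos in auto)
  with 1 show ?thesis unfolding digits_def
    by (simp add: k mult.commute del: mult_Suc_right mult_Suc)
qed

lemma branch_mem:
  assumes m: "m \<in> digits a N" and y: "y \<in> open_unit b"
  shows "real N / (real m - real b + y) \<in> open_unit a"
proof -
  have u: "real m < real m - real b + y" "real m - real b + y < real m + 1"
    using y by (auto simp: open_unit_def)
  have m0: "real m > 0" using digits_gt[OF m] by simp
  have "real a \<le> real N / (real m + 1)" by (rule digits_bounds(1)[OF m])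
  also have "\<dots> < real N / (real m - real b + y)"
    using u m0 N_pos by (intro divide_strict_left_mono) auto
  finally have 1: "real a < real N / (real m - real b + y)" .
  have "real N / (real m - real b + y) < real N / real m"
    using u m0 N_pos by (intro divide_strict_left_mono) auto
  also have "\<dots> \<le> real a + 1" by (rule digits_bounds(2)[OF m])
  finally show ?thesis using 1 by (simp add: open_unit_def)
qed

text \<open>Duality between composition with T and the transfer operator: the cells of the digits
  partition the interval up to a null set, and each cell is treated by
  \<open>nn_integral_inverse_branch\<close>.\<close>

lemma nn_integral_transfer_op:
  fixes f g :: "real \<Rightarrow> ennreal"
  assumes [measurable]: "f \<in> borel_measurable borel" "g \<in> borel_measurable borel"
  shows "(\<integral>\<^sup>+x. g (real N / x - of_int \<lfloor>real N / x\<rfloor> + real b) * f x * indicator (open_unit a) x \<partial>lborel)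
       = (\<integral>\<^sup>+y. g y * transfer_op a b N f y * indicator (open_unit b) y \<partial>lborel)"
proof -
  define G where "G m x = (if m \<in> digits a N then g (real N / x - real m + real b) * f x
      * indicator {real N / (real m + 1)<..real N / real m} x else 0)" for m :: nat and x
  define H where "H m y = (if m \<in> digits a N then g y *
      (ennreal (real N / (real m - real b + y)\<^sup>2) * f (real N / (real m - real b + y)))
            * indicator (open_unit b) y else 0)" for m :: nat and y
  have [measurable]: "G m \<in> borel_measurable borel" for m unfolding G_def[abs_def] by measurable
  have [measurable]: "H m \<in> borel_measurable borel" for m
    unfolding H_def[abs_def] open_unit_def by measurable
  \<comment> \<open>The point a + 1 has to be excluded: it is the closed right end of the cell of
    the least digit N / (a + 1), yet lies outside the open interval.\<close>
  have split: "g (real N / x - of_int \<lfloor>real N / x\<rfloor> + real b) * f x * indicator (open_unit a) x = (\<Sum>m. G m x)"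
    if "x \<noteq> real a + 1" for x
  proof (cases "x \<in> open_unit a")
    case True
    define n where "n = nat \<lfloor>real N / x\<rfloor>"
    have x: "real a < x" "x \<le> real a + 1" "x > 0" using True by (auto simp: open_unit_def)
    have n: "n \<in> digits a N" using floor_mem_digits[OF x(1,2)] n_def by simp
    have n': "int n = \<lfloor>real N / x\<rfloor>" "real n = of_int \<lfloor>real N / x\<rfloor>"
      using x unfolding n_def by auto
    have iff: "x \<in> {real N / (real m + 1)<..real N / real m} \<longleftrightarrow> m = n" if "m \<in> digits a N" for m
    proof -
      have m: "real m > 0" using digits_gt[OF that] by simp
      have "x \<in> {real N / (real m + 1)<..real N / real m} \<longleftrightarrow> real m \<le> real N / x \<and> real N / x < real m + 1"
        using m x by (auto simp: field_simps)
      also have "\<dots> \<longleftrightarrow> \<lfloor>real N / x\<rfloor> = int m" by (simp add: floor_eq_iff)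
      also have "\<dots> \<longleftrightarrow> m = n" using n' by linarith
      finally show ?thesis .
    qed
    have "(\<Sum>m. G m x) = (\<Sum>m\<in>{n}. G m x)"
      by (rule suminf_finite) (use iff in \<open>auto simp: G_def indicator_def\<close>)
    also have "\<dots> = g (real N / x - of_int \<lfloor>real N / x\<rfloor> + real b) * f x * indicator (open_unit a) x"
      using n True iff[OF n] by (simp add: G_def n'(2))
    finally show ?thesis by simp
  next
    case False
    have "G m x = 0" for m
    proof (cases "m \<in> digits a N \<and> x \<in> {real N / (real m + 1)<..real N / real m}")
      case True
      then have m: "m \<in> digits a N" "real m > 0" using digits_gt[of m] by auto
      from digits_bounds[OF m(1)] have "x \<in> open_unit a" using True that by (auto simp: open_unit_def)
      with False show ?thesis by simp
    qed (auto simp: G_def)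
    then show ?thesis using False by simp
  qed
  have "(\<integral>\<^sup>+x. g (real N / x - of_int \<lfloor>real N / x\<rfloor> + real b) * f x * indicator (open_unit a) x \<partial>lborel)
      = (\<integral>\<^sup>+x. (\<Sum>m. G m x) \<partial>lborel)"
    by (intro nn_integral_cong_AE)
       (use AE_lborel_singleton[of "real a + 1"] in \<open>eventually_elim, simp add: split\<close>)
  also have "\<dots> = (\<Sum>m. \<integral>\<^sup>+x. G m x \<partial>lborel)" by (rule nn_integral_suminf) auto
  also have "\<dots> = (\<Sum>m. \<integral>\<^sup>+y. H m y \<partial>lborel)"
  proof (intro suminf_cong)
    fix m
    show "(\<integral>\<^sup>+x. G m x \<partial>lborel) = (\<integral>\<^sup>+y. H m y \<partial>lborel)"
    proof (cases "m \<in> digits a N")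
      case True
      then have "0 < m" using digits_gt by fastforce
      from nn_integral_inverse_branch[OF assms this, of N b] True
      show ?thesis by (simp add: G_def H_def)
    qed (simp add: G_def H_def)
  qed
  also have "\<dots> = (\<integral>\<^sup>+y. (\<Sum>m. H m y) \<partial>lborel)" by (rule nn_integral_suminf[symmetric]) auto
  also have "\<dots> = (\<integral>\<^sup>+y. g y * transfer_op a b N f y * indicator (open_unit b) y \<partial>lborel)"
  proof (intro nn_integral_cong)
    fix y
    have "(\<Sum>m. H m y) = (\<Sum>m. (g y * indicator (open_unit b) y) * (if m \<in> digits a N
        then ennreal (real N / (real m - real b + y)\<^sup>2) * f (real N / (real m - real b + y)) else 0))"
      by (intro suminf_cong) (auto simp: H_def mult_ac)
    then show "(\<Sum>m. H m y) = g y * transfer_op a b N f y * indicator (open_unit b) y"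
      by (simp add: transfer_op_def mult_ac)
  qed
  finally show ?thesis .
qed

end

subsection \<open>Invariant density and log-Lipschitz functions\<close>

text \<open>For x \<ge> 0 and N > 0 this is the integral of N / (N + t x)^2 over t in [c, c + 1]. On
  one of the two intervals, \<open>c\<close> is the left endpoint of the other.\<close>

definition dens :: "nat \<Rightarrow> nat \<Rightarrow> real \<Rightarrow> real" where
  "dens c N x = (real c + 1) / (real N + (real c + 1) * x) - real c / (real N + real c * x)"

lemma dens_measurable [measurable]: "dens c N \<in> borel_measurable borel"
  unfolding dens_def[abs_def] by measurable

lemma dens_pos:
  assumes "0 \<le> x" "0 < N"
  shows "0 < dens c N x"
proof -
  have "0 < real N + (real c + 1) * x" "0 < real N + real c * x"
    using assms by (simp_all add: add_pos_nonneg)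
  then have "dens c N x = real N / ((real N + (real c + 1) * x) * (real N + real c * x))"
    unfolding dens_def by (simp add: field_simps)
  also have "\<dots> > 0"
    using \<open>0 < real N + (real c + 1) * x\<close> \<open>0 < real N + real c * x\<close> assms by simp
  finally show ?thesis .
qed

context branches
begin

text \<open>With u = m - b + y, the weighted term N / u^2 * dens b (N / u) equals 1 / (u + b) - 1 /
  (u + b + 1), and u + b = m + y. The sum over the digits telescopes, and its ends at N / (a + 1)
  and N / a give the two terms of \<open>dens a N y\<close>.\<close>

lemma transfer_op_dens:
  assumes y: "y \<in> open_unit b"
  shows "transfer_op a b N (\<lambda>x. ennreal (dens b N x)) y = ennreal (dens a N y)"
proof -
  have y0: "real b < y" "y > 0" using y by (auto simp: open_unit_def)
  have N0: "real N > 0" using N_pos by simp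
  \<comment> \<open>\<open>q m\<close> is \<open>1 / (m' + y)\<close> with \<open>m'\<close> the truncation of \<open>m\<close> to \<open>[N / (a + 1), N / a]\<close>, so that a single
    telescoping series covers both \<open>a = 0\<close> (infinitely many digits) and \<open>a > 0\<close>.\<close>
  define q where "q m = (if N \<le> m * a then real a / (real N + real a * y)
      else if m * (a + 1) \<le> N then (real a + 1) / (real N + (real a + 1) * y)
      else 1 / (real m + y))" for m :: nat
  have q_Suc: "q m - q (Suc m) = (if m \<in> digits a N then 1 / (real m + y) - 1 / (real m + 1 + y) else 0)" for m
  proof -
    \<comment> \<open>At both cut-offs n = N / (a + 1) and n = N / a the truncated value agrees with
      1 / (n + y). Thus for a digit m neither \<open>q m\<close> nor \<open>q (Suc m)\<close> is
      affected by the truncation.\<close>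
    have qa: "q n = 1 / (real n + y)" if n_le: "N \<le> n * (a + 1)" "n * a \<le> N" for n
    proof -
      have n: "n > 0" using n_le N_pos by (auto intro!: gr0I)
      consider "N = n * a" | "N = n * (a + 1)" "n * a < N" | "n * a < N" "N < n * (a + 1)"
        using n_le unfolding le_less by metis
      then show ?thesis
      proof cases
        case 1
        then have e: "real N = real n * real a" by simp
        then have "real a > 0" using N0 by (simp add: zero_less_mult_iff)
        then have "real n * real a + real a * y > 0" using y0 n by (intro add_pos_pos) auto
        then show ?thesis using 1 y0 n N0 e by (simp add: q_def field_simps)
      next
        case 2
        then have e: "real N = real n * (real a + 1)" by (simp add: algebra_simps)
        have "real n * (real a + 1) + (real a + 1) * y > 0" using y0 n by (intro add_pos_pos) auto
        then have "(real a + 1) / (real n * (real a + 1) + (real a + 1) * y) = 1 / (real n + y)"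
          using y0 by (simp add: divide_eq_eq nonzero_eq_divide_eq) (simp add: algebra_simps)
        then show ?thesis unfolding q_def e using 2 by simp
      qed (simp add: q_def)
    qed
    consider "m \<in> digits a N" | "N \<le> m * a" | "m * (a + 1) < N"
      unfolding digits_def by force
    then show ?thesis
    proof cases
      case 1
      have "real ((m + 1) * a) \<le> real N"
        using digits_bounds(1)[OF 1] by (simp add: pos_le_divide_eq algebra_simps)
      then have "Suc m * a \<le> N" by (simp only: of_nat_le_iff Suc_eq_plus1)
      moreover have "N \<le> Suc m * (a + 1)" using 1 by (simp add: digits_def)
      ultimately have "q (Suc m) = 1 / (real (Suc m) + y)" by (intro qa)
      moreover have "q m = 1 / (real m + y)" using 1 by (intro qa) (simp_all add: digits_def)
      ultimately show ?thesis using 1 by (simp add: add_ac)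
    next
      case 2
      then show ?thesis by (auto simp: q_def digits_def)
    next
      case 3
      obtain k where k: "N = k * (a + 1)" using Suc_a_dvd by (metis dvd_def mult.commute)
      have "m < k" using 3 unfolding k by (metis mult_less_cancel2)
      then have 4: "Suc m * (a + 1) \<le> N" unfolding k by (intro mult_le_mono1) simp
      have "Suc m * a < Suc m * (a + 1)" "m * a \<le> m * (a + 1)" by simp_all
      then have "Suc m * a < N" "m * a < N" "m * (a + 1) \<le> N" using 4 3 by linarith+
      then show ?thesis using 4 3 by (simp add: q_def digits_def)
    qed
  qed
  have "q \<longlonglongrightarrow> real a / (real N + real a * y)"
  proof (cases "a = 0")
    case True
    have "(\<lambda>m. 1 / (real m + y)) \<longlonglongrightarrow> 0" by real_asymp
    moreover have "eventually (\<lambda>m. 1 / (real m + y) = q m) sequentially"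
      using eventually_gt_at_top[of N] by eventually_elim (use N_pos True in \<open>auto simp: q_def\<close>)
    ultimately show ?thesis using True by (simp add: tendsto_cong)
  next
    case False
    have "eventually (\<lambda>m. q m = real a / (real N + real a * y)) sequentially"
      using eventually_ge_at_top[of N]
    proof eventually_elim
      case (elim m)
      have "m * 1 \<le> m * a" using False by (intro mult_le_mono2) simp
      then have "N \<le> m * a" using elim by linarith
      then show ?case by (simp add: q_def)
    qed
    then show ?thesis by (simp add: tendsto_eventually)
  qed
  moreover have "q 0 = (real a + 1) / (real N + (real a + 1) * y)"
    using N_pos by (simp add: q_def)
  ultimately have sums: "(\<lambda>m. if m \<in> digits a N then 1 / (real m + y) - 1 / (real m + 1 + y) else 0) sums dens a N y"
    unfolding dens_def using telescope_sums'[of q] by (simp add: q_Suc)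
  have summand: "(if m \<in> digits a N then ennreal (real N / (real m - real b + y)\<^sup>2) *
        ennreal (dens b N (real N / (real m - real b + y))) else 0)
     = ennreal (if m \<in> digits a N then 1 / (real m + y) - 1 / (real m + 1 + y) else 0)" for m
  proof (cases "m \<in> digits a N")
    case True
    define u where "u = real m - real b + y"
    have u: "u > 0" using y0 digits_gt[OF True] by (auto simp: u_def)
    have e: "dens b N (real N / u) = u / N * ((real b + 1) / (u + real b + 1) - real b / (u + real b))"
    proof -
      have "real N + (real b + 1) * (real N / u) = real N / u * (u + real b + 1)"
        "real N + real b * (real N / u) = real N / u * (u + real b)"
        using u by (simp_all add: field_simps)
      then show ?thesis unfolding dens_def using u N0 by (simp add: diff_divide_distrib right_diff_distrib mult.commute[of u])
    qed
    have "real N / u\<^sup>2 * dens b N (real N / u) = ((real b + 1) / (u + real b + 1) - real b / (u + real b)) / u"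
      unfolding e using u N0 by (simp add: power2_eq_square)
    also have "\<dots> = 1 / (u + real b) - 1 / (u + real b + 1)"
    proof -
      have "u + real b > 0" "u + real b + 1 > 0" using u by auto
      then show ?thesis using u by (simp add: divide_simps) (simp add: algebra_simps)
    qed
    also have "\<dots> = 1 / (real m + y) - 1 / (real m + 1 + y)" by (simp add: u_def add_ac)
    finally show ?thesis using True
      by (simp add: u_def ennreal_mult'[symmetric])
  qed simp
  have nn: "0 \<le> (if m \<in> digits a N then 1 / (real m + y) - 1 / (real m + 1 + y) else 0)" for m
    using y0 by (auto simp: field_simps)
  have "transfer_op a b N (\<lambda>x. ennreal (dens b N x)) y
      = (\<Sum>m. ennreal (if m \<in> digits a N then 1 / (real m + y) - 1 / (real m + 1 + y) else 0))"
    unfolding transfer_op_def by (intro suminf_cong) (rule summand)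
  also have "\<dots> = ennreal (dens a N y)"
    using sums nn by (simp add: suminf_ennreal2 sums_iff)
  finally show ?thesis .
qed

end

section \<open>The logarithmic distance and the contraction by inverse branches\<close>

definition log_dist :: "real \<Rightarrow> real \<Rightarrow> real" where
  "log_dist x y = \<bar>ln (x + 1/2) - ln (y + 1/2)\<bar>"

text \<open>The multiplicative form of a Lipschitz bound for ln f: it makes sense for the values 0
  and infinity and is preserved by sums of functions.\<close>

definition log_lipschitz :: "real \<Rightarrow> real set \<Rightarrow> (real \<Rightarrow> ennreal) \<Rightarrow> bool" where
  "log_lipschitz K S f \<longleftrightarrow> (\<forall>x\<in>S. \<forall>y\<in>S. f x \<le> ennreal (exp (K * log_dist x y)) * f y)"

lemma log_dist_commute: "log_dist x y = log_dist y x"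
  by (simp add: log_dist_def abs_minus_commute)

lemma log_dist_nonneg: "0 \<le> log_dist x y"
  by (simp add: log_dist_def)

text \<open>Compare derivatives: 1 / (k + t) is at most (t + 1/2) / (t + 1) times 1 / (t + 1/2), and
  this factor increases in t, so its value at c bounds it. The shift 1/2 in \<open>log_dist\<close>
  is positive, keeping the distance finite at 0, and below 1 \<le> k, making the factor less than
  1.\<close>

lemma ln_shift_contraction:
  fixes k c y y' :: real
  assumes "1 \<le> k" "0 \<le> y" "y \<le> c" "0 \<le> y'" "y' \<le> c"
  shows "\<bar>ln (k + y) - ln (k + y')\<bar> \<le> (c + 1/2) / (c + 1) * log_dist y y'"
proof -
  have *: "ln (k + y') - ln (k + y) \<le> (c + 1/2) / (c + 1) * log_dist y y'"
    if "0 \<le> y" "y \<le> y'" "y' \<le> c" for y y'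
  proof -
    let ?G = "\<lambda>t. (c + 1/2) / (c + 1) * ln (t + 1/2) - ln (k + t)"
    have "?G y \<le> ?G y'"
    proof (rule DERIV_nonneg_imp_nondecreasing[OF that(2)])
      fix t assume t: "y \<le> t" "t \<le> y'"
      then have t': "0 \<le> t" "t \<le> c" using that by auto
      have "(?G has_real_derivative (c + 1/2) / (c + 1) * (1 / (t + 1/2)) - 1 / (k + t)) (at t)"
        using t' assms(1) by (auto intro!: derivative_eq_intros)
      moreover have "0 \<le> (c + 1/2) / (c + 1) * (1 / (t + 1/2)) - 1 / (k + t)"
      proof -
        have "(t + 1/2) * (c + 1) \<le> (c + 1/2) * (1 + t)" using t' by (simp add: field_simps)
        also have "\<dots> \<le> (c + 1/2) * (k + t)" using t' assms(1) by (intro mult_left_mono) auto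
        finally have "(c + 1) * (t + 1/2) \<le> (c + 1/2) * (k + t)" by (simp only: mult.commute)
        moreover have "0 < (c + 1) * (t + 1/2)" "0 < k + t" using t' assms(1) by auto
        ultimately have "1 / (k + t) \<le> (c + 1/2) / ((c + 1) * (t + 1/2))"
          by (simp only: pos_le_divide_eq) (simp add: pos_divide_le_eq)
        then show ?thesis by simp
      qed
      ultimately show "\<exists>d. (?G has_real_derivative d) (at t) \<and> 0 \<le> d" by blast
    qed
    moreover have "log_dist y y' = ln (y' + 1/2) - ln (y + 1/2)"
      using that by (auto simp: log_dist_def)
    ultimately show ?thesis by (simp add: right_diff_distrib)
  qed
  show ?thesis
  proof (cases "y \<le> y'")
    case True
    then show ?thesis using *[of y y'] assms by (auto simp: abs_if)
  next
    case False
    then show ?thesis using *[of y' y] assms by (auto simp: abs_if log_dist_commute)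
  qed
qed

text \<open>The product (c / u + 1/2) * u = c + u / 2 increases with u, so ln (c / u + 1/2)
  decreases no faster than ln u increases.\<close>

lemma log_dist_inverse_le:
  assumes "0 < u" "0 < u'" "0 \<le> c"
  shows "log_dist (c / u) (c / u') \<le> \<bar>ln u - ln u'\<bar>"
proof -
  have *: "log_dist (c / u) (c / u') \<le> ln u' - ln u" if "0 < u" "u \<le> u'" for u u'
  proof -
    have "c / u' \<le> c / u" using that assms(3) by (intro divide_left_mono) auto
    moreover have nn: "0 \<le> c / u'" "0 \<le> c / u" using that assms(3) by auto
    ultimately have "log_dist (c / u) (c / u') = ln (c / u + 1/2) - ln (c / u' + 1/2)"
      by (auto simp: log_dist_def)
    moreover have "ln ((c / u + 1/2) * u) \<le> ln ((c / u' + 1/2) * u')"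
      using that assms(3) nn by (subst ln_le_cancel_iff) (auto simp: distrib_right add_pos_nonneg)
    then have "ln (c / u + 1/2) + ln u \<le> ln (c / u' + 1/2) + ln u'"
      using that nn by (subst (asm) (1 2) ln_mult_pos) auto
    ultimately show ?thesis by linarith
  qed
  show ?thesis
  proof (cases "u \<le> u'")
    case True
    then show ?thesis using *[of u u'] assms by auto
  next
    case False
    then show ?thesis using *[of u' u] assms by (auto simp: log_dist_commute)
  qed
qed

context branches
begin

text \<open>The bound holds for each summand and survives summation. The weight N / u^2 contributes
  2, because ln u is 1-Lipschitz for \<open>log_dist\<close>; the factor f contributes K times the
  contraction rate of the branch.\<close>

lemma log_lipschitz_transfer_op:
  assumes f: "log_lipschitz K (open_unit a) f" and K: "0 \<le> K"
    and \<beta>: "(real b + 3/2) / (real b + 2) \<le> \<beta>"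
  shows "log_lipschitz (\<beta> * K + 2) (open_unit b) (transfer_op a b N f)"
  unfolding log_lipschitz_def
proof (intro ballI)
  fix y y' assume y: "y \<in> open_unit b" "y' \<in> open_unit b"
  let ?d = "log_dist y y'"
  have "(if m \<in> digits a N
        then ennreal (real N / (real m - real b + y)\<^sup>2) * f (real N / (real m - real b + y)) else 0)
      \<le> ennreal (exp ((\<beta> * K + 2) * ?d)) * (if m \<in> digits a N
        then ennreal (real N / (real m - real b + y')\<^sup>2) * f (real N / (real m - real b + y')) else 0)" for m
  proof (cases "m \<in> digits a N")
    case True
    define u u' where "u = real m - real b + y" and "u' = real m - real b + y'"
    have u: "0 < u" "0 < u'" using y digits_gt[OF True] by (auto simp: u_def u'_def open_unit_def)
    \<comment> \<open>Here the contraction lemma is used with k = m - b \<ge> 1 and c = b + 1, which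
      is the origin of (b + 3/2) / (b + 2).\<close>
    have "\<bar>ln u - ln u'\<bar> \<le> (real b + 1 + 1/2) / (real b + 1 + 1) * ?d"
      unfolding u_def u'_def using y digits_gt[OF True]
      by (intro ln_shift_contraction) (auto simp: open_unit_def)
    then have ctr: "\<bar>ln u - ln u'\<bar> \<le> (real b + 3/2) / (real b + 2) * ?d" by (simp add: add_ac)
    also have "\<dots> \<le> 1 * ?d" by (intro mult_right_mono log_dist_nonneg) simp
    finally have "ln u' - ln u \<le> ?d" by simp
    then have "u' / u \<le> exp ?d" using u by (metis exp_diff exp_le_cancel_iff exp_ln)
    then have "(u' / u)\<^sup>2 \<le> (exp ?d)\<^sup>2" using u by (intro power_mono) auto
    also have "(exp ?d)\<^sup>2 = exp (2 * ?d)" by (simp add: exp_double)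
    finally have "real N / u\<^sup>2 \<le> exp (2 * ?d) * (real N / u'\<^sup>2)"
      using u N_pos by (simp add: divide_simps mult_ac)
    then have w: "ennreal (real N / u\<^sup>2) \<le> ennreal (exp (2 * ?d)) * ennreal (real N / u'\<^sup>2)"
      by (simp flip: ennreal_mult)
    have "log_dist (real N / u) (real N / u') \<le> \<beta> * ?d"
      using log_dist_inverse_le[OF u, of "real N"] ctr mult_right_mono[OF \<beta> log_dist_nonneg[of y y']] by simp
    then have "K * log_dist (real N / u) (real N / u') \<le> K * (\<beta> * ?d)" using K by (rule mult_left_mono)
    then have e: "exp (K * log_dist (real N / u) (real N / u')) \<le> exp (\<beta> * K * ?d)" by (simp add: mult_ac)
    have "f (real N / u) \<le> ennreal (exp (K * log_dist (real N / u) (real N / u'))) * f (real N / u')"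
      using f branch_mem[OF True] y unfolding log_lipschitz_def u_def u'_def by blast
    also have "\<dots> \<le> ennreal (exp (\<beta> * K * ?d)) * f (real N / u')"
      by (intro mult_right_mono ennreal_leI e) simp
    finally have "ennreal (real N / u\<^sup>2) * f (real N / u)
        \<le> (ennreal (exp (2 * ?d)) * ennreal (real N / u'\<^sup>2)) * (ennreal (exp (\<beta> * K * ?d)) * f (real N / u'))"
      using w by (intro mult_mono) auto
    also have "\<dots> = ennreal (exp (\<beta> * K * ?d) * exp (2 * ?d)) * (ennreal (real N / u'\<^sup>2) * f (real N / u'))"
      by (simp add: ennreal_mult mult_ac)
    finally show ?thesis using True
      by (simp add: u_def u'_def distrib_right exp_add)
  qed simp
  then have "transfer_op a b N f y \<le> (\<Sum>m. ennreal (exp ((\<beta> * K + 2) * ?d)) * (if m \<in> digits a N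
        then ennreal (real N / (real m - real b + y')\<^sup>2) * f (real N / (real m - real b + y')) else 0))"
    unfolding transfer_op_def by (intro suminf_le) auto
  then show "transfer_op a b N f y \<le> ennreal (exp ((\<beta> * K + 2) * ?d)) * transfer_op a b N f y'"
    by (simp add: transfer_op_def)
qed

end

lemma log_dist_le:
  assumes "0 \<le> x" "0 \<le> y"
  shows "log_dist x y \<le> 2 * \<bar>x - y\<bar>"
proof -
  have *: "ln (y + 1/2) - ln (x + 1/2) \<le> 2 * (y - x)" if "0 \<le> x" "x \<le> y" for x y :: real
  proof -
    have "ln (y + 1/2) - ln (x + 1/2) = ln ((y + 1/2) / (x + 1/2))" using that by (simp add: ln_div)
    also have "\<dots> \<le> (y + 1/2) / (x + 1/2) - 1" using that by (intro ln_le_minus_one) simp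
    also have "\<dots> = (y - x) / (x + 1/2)" using that by (simp add: field_simps)
    also have "\<dots> \<le> (y - x) / (1/2)" using that by (intro divide_left_mono) auto
    finally show ?thesis by simp
  qed
  show ?thesis
    using *[of x y] *[of y x] assms by (cases "x \<le> y") (auto simp: log_dist_def abs_if)
qed

text \<open>The derivative of ln (t + 1/2) is at least 1 / (c + 1/2) on [0, c]. This turns Euclidean
  Lipschitz bounds into bounds for \<open>log_dist\<close>.\<close>

lemma abs_diff_le_log_dist:
  assumes "0 \<le> x" "0 \<le> y" "x \<le> c" "y \<le> c"
  shows "\<bar>x - y\<bar> \<le> (c + 1/2) * log_dist x y"
proof -
  have *: "y - x \<le> (c + 1/2) * (ln (y + 1/2) - ln (x + 1/2))" if "0 \<le> x" "x \<le> y" "y \<le> c" for x y :: real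
  proof -
    have "ln ((x + 1/2) / (y + 1/2)) \<le> (x + 1/2) / (y + 1/2) - 1" using that by (intro ln_le_minus_one) simp
    moreover have "(x + 1/2) / (y + 1/2) - 1 = - ((y - x) / (y + 1/2))" using that by (simp add: field_simps)
    ultimately have "(y - x) / (y + 1/2) \<le> ln (y + 1/2) - ln (x + 1/2)"
      using that by (simp add: ln_div)
    then have "y - x \<le> (y + 1/2) * (ln (y + 1/2) - ln (x + 1/2))"
      using that by (simp add: pos_divide_le_eq mult.commute)
    also have "\<dots> \<le> (c + 1/2) * (ln (y + 1/2) - ln (x + 1/2))"
      using that by (intro mult_right_mono) auto
    finally show ?thesis .
  qed
  show ?thesis
    using *[of x y] *[of y x] assms by (cases "x \<le> y") (auto simp: log_dist_def abs_if)
qed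

subsection \<open>Uniqueness of absolutely continuous invariant measures\<close>

text \<open>Ergodicity is stated for strictly invariant sets, so A is replaced by the set B of
  points whose orbit is eventually in A. Dropping the first point of an orbit does not affect
  membership in B, and B agrees with A almost everywhere.\<close>

lemma ergodic_measure_AE_invariant:
  assumes M: "prob_space M" and inv: "invariant_measure T M" and erg: "ergodic_measure T M"
    and A [measurable]: "A \<in> sets M" and AE: "AE x in M. T x \<in> A \<longleftrightarrow> x \<in> A"
  shows "measure M A = 0 \<or> measure M A = 1"
proof -
  interpret prob_space M by fact
  have T [measurable]: "T \<in> measurable M M" and TM: "distr M M T = M"
    using inv by (auto simp: invariant_measure_def)
  have Tn [measurable]: "(T ^^ n) \<in> measurable M M" for n
    by (induction n) auto
  have "AE x in M. (T ^^ n) x \<in> A \<longleftrightarrow> x \<in> A" for n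
  proof (induction n)
    case (Suc n)
    \<comment> \<open>Invariance lets an almost-everywhere statement at x be read at T x.\<close>
    have "AE x in distr M M T. (T ^^ n) x \<in> A \<longleftrightarrow> x \<in> A" unfolding TM by (rule Suc)
    then have "AE x in M. (T ^^ n) (T x) \<in> A \<longleftrightarrow> T x \<in> A" by (subst (asm) AE_distr_iff) auto
    then show ?case using AE by eventually_elim (simp add: funpow_swap1)
  qed simp
  then have all: "AE x in M. \<forall>n. (T ^^ n) x \<in> A \<longleftrightarrow> x \<in> A" by (simp add: AE_all_countable)
  define B where "B = {x \<in> space M. \<exists>n. \<forall>m\<ge>n. (T ^^ m) x \<in> A}"
  have B [measurable]: "B \<in> sets M" unfolding B_def by measurable
  have "T -` B \<inter> space M = B"
  proof (intro subset_antisym subsetI)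
    fix x assume "x \<in> T -` B \<inter> space M"
    then have x: "x \<in> space M" "T x \<in> B" by auto
    then obtain n where n: "\<And>m. m \<ge> n \<Longrightarrow> (T ^^ m) (T x) \<in> A" by (auto simp: B_def)
    have "(T ^^ m) x \<in> A" if "m \<ge> Suc n" for m
      using n[of "m - 1"] that by (cases m) (auto simp: funpow_swap1)
    then show "x \<in> B" using x by (auto simp: B_def)
  next
    fix x assume x: "x \<in> B"
    then obtain n where n: "\<And>m. m \<ge> n \<Longrightarrow> (T ^^ m) x \<in> A" and xs: "x \<in> space M" by (auto simp: B_def)
    have "(T ^^ m) (T x) \<in> A" if "m \<ge> n" for m
      using n[of "Suc m"] that by (simp add: funpow_swap1)
    then show "x \<in> T -` B \<inter> space M" using xs measurable_space[OF T xs] by (auto simp: B_def)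
  qed
  then have "measure M B = 0 \<or> measure M B = 1" using erg B by (auto simp: ergodic_measure_def)
  moreover have "measure M B = measure M A"
  proof (rule measure_eq_AE)
    show "AE x in M. x \<in> B \<longleftrightarrow> x \<in> A"
      using all AE_space by eventually_elim (auto simp: B_def)
  qed auto
  ultimately show ?thesis by simp
qed

text \<open>Invariance of both measures forces the superlevel set \<open>{h > 1}\<close> of the density \<open>h\<close> to be
  invariant modulo null sets, so that no ergodic theorem is needed.\<close>

lemma ergodic_absolutely_continuous_unique:
  assumes M: "prob_space M" and inv: "invariant_measure T M" and erg: "ergodic_measure T M"
    and N: "prob_space N" and sets: "sets N = sets M" and invN: "invariant_measure T N"
    and ac: "absolutely_continuous M N"
  shows "N = M"
proof -
  interpret M: prob_space M by fact
  interpret N: prob_space N by fact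
  have T [measurable]: "T \<in> measurable M M" and TM: "distr M M T = M"
    using inv by (auto simp: invariant_measure_def)
  have TN: "T \<in> measurable N N" "distr N N T = N"
    using invN by (auto simp: invariant_measure_def)
  have spaceN: "space N = space M" using sets by (rule sets_eq_imp_space_eq)
  define h where "h = RN_deriv M N"
  have h [measurable]: "h \<in> borel_measurable M" by (simp add: h_def)
  have dens: "density M h = N" unfolding h_def by (rule M.density_RN_deriv[OF ac sets])
  have int_h: "emeasure N B = (\<integral>\<^sup>+x. h x * indicator B x \<partial>M)" if "B \<in> sets M" for B
    using that by (simp add: dens[symmetric] emeasure_density)
  define A where "A = {x \<in> space M. 1 < h x}"
  define B1 where "B1 = A - (T -` A \<inter> space M)"
  define B2 where "B2 = (T -` A \<inter> space M) - A"
  have A [measurable]: "A \<in> sets M" unfolding A_def by measurable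
  have TA: "T -` A \<inter> space M \<in> sets M" by measurable
  have B [measurable]: "B1 \<in> sets M" "B2 \<in> sets M" unfolding B1_def B2_def using TA by auto
  \<comment> \<open>An invariant measure gives A and its preimage equal mass, so the two halves of
    their symmetric difference have equal mass as well.\<close>
  have swap: "measure L B1 = measure L B2"
    if "prob_space L" "measure L A = measure L (T -` A \<inter> space M)" "sets L = sets M" for L
  proof -
    interpret L: prob_space L by fact
    have m [measurable]: "A \<in> sets L" "T -` A \<inter> space M \<in> sets L" using that TA by auto
    have "measure L B1 = measure L A - measure L (A \<inter> (T -` A \<inter> space M))"
      unfolding B1_def by (rule L.finite_measure_Diff') auto
    moreover have "measure L B2 = measure L (T -` A \<inter> space M) - measure L ((T -` A \<inter> space M) \<inter> A)"
      unfolding B2_def by (rule L.finite_measure_Diff') auto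
    ultimately show ?thesis using that by (simp add: Int_commute)
  qed
  have "measure M A = measure M (T -` A \<inter> space M)"
    using measure_distr[OF T A] by (simp add: TM)
  then have sM: "emeasure M B1 = emeasure M B2"
    using swap[OF M] by (simp add: M.emeasure_eq_measure)
  have "measure N A = measure N (T -` A \<inter> space M)"
    using measure_distr[OF TN(1), of A] sets by (simp add: TN(2) spaceN)
  then have sN: "emeasure N B1 = emeasure N B2"
    using swap[OF N] sets by (simp add: N.emeasure_eq_measure)
  \<comment> \<open>Since h > 1 on B1 and h \<le> 1 on B2, positive mass of B1 would give N B2 \<le>
    M B2 = M B1 < N B1, against the equality for N.\<close>
  have "emeasure M B1 = 0"
  proof (rule ccontr)
    assume pos: "emeasure M B1 \<noteq> 0"
    have gt_one: "1 < h x" if "x \<in> B1" for x using that by (simp add: B1_def A_def)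
    have "emeasure N B2 \<le> emeasure M B2"
    proof -
      have "emeasure N B2 \<le> (\<integral>\<^sup>+x. indicator B2 x \<partial>M)"
        unfolding int_h[OF B(2)]
        by (intro nn_integral_mono) (auto simp: indicator_def B2_def A_def not_less)
      then show ?thesis by simp
    qed
    also have "\<dots> = (\<integral>\<^sup>+x. indicator B1 x \<partial>M)" using sM by simp
    also have "\<dots> < (\<integral>\<^sup>+x. h x * indicator B1 x \<partial>M)"
    proof (rule nn_integral_less)
      show "\<not> (AE x in M. h x * indicator B1 x \<le> indicator B1 x)"
      proof
        assume "AE x in M. h x * indicator B1 x \<le> indicator B1 x"
        then have "AE x in M. x \<notin> B1"
          by eventually_elim (use gt_one in \<open>auto simp: indicator_def not_less[symmetric]\<close>)
        moreover have "{x \<in> space M. \<not> x \<notin> B1} = B1" using sets.sets_into_space[OF B(1)] by auto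
        note AE_iff_measurable[OF B(1) this]
        ultimately show False using pos by simp
      qed
      show "(\<integral>\<^sup>+x. indicator B1 x \<partial>M) \<noteq> \<infinity>" by (simp add: M.emeasure_eq_measure)
      show "AE x in M. indicator B1 x \<le> h x * indicator B1 x"
        using gt_one by (intro AE_I2) (auto simp: indicator_def less_imp_le)
    qed auto
    also have "\<dots> = emeasure N B1" by (simp add: int_h)
    finally show False using sN by simp
  qed
  then have null: "B1 \<in> null_sets M" "B2 \<in> null_sets M" using sM by auto
  have AE_A: "AE x in M. T x \<in> A \<longleftrightarrow> x \<in> A"
    using AE_not_in[OF null(1)] AE_not_in[OF null(2)] AE_space
    by eventually_elim (auto simp: B1_def B2_def)
  have tot: "(\<integral>\<^sup>+x. h x \<partial>M) = 1"
  proof -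
    have "(\<integral>\<^sup>+x. h x \<partial>M) = (\<integral>\<^sup>+x. h x * indicator (space M) x \<partial>M)" by (intro nn_integral_cong) auto
    also have "\<dots> = 1" using int_h[of "space M"] N.emeasure_space_1 spaceN by simp
    finally show ?thesis .
  qed
  have one: "(\<integral>\<^sup>+x. 1 \<partial>M) = 1" by (simp add: M.emeasure_space_1)
  \<comment> \<open>By ergodicity A is null or of full measure. In the latter case h > 1 almost
    everywhere, so that h would have integral greater than 1.\<close>
  have "AE x in M. h x \<le> 1"
    using ergodic_measure_AE_invariant[OF M inv erg A AE_A]
  proof
    assume "measure M A = 0"
    then have "A \<in> null_sets M" using A by (simp add: M.emeasure_eq_measure null_sets_def)
    from AE_not_in[OF this] AE_space show ?thesis by eventually_elim (auto simp: A_def)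
  next
    assume "measure M A = 1"
    then have "AE x in M. x \<in> A" using M.prob_eq_1[OF A] by simp
    then have gt: "AE x in M. 1 < h x" by eventually_elim (simp add: A_def)
    have "(\<integral>\<^sup>+x. 1 \<partial>M) < (\<integral>\<^sup>+x. h x \<partial>M)"
    proof (rule nn_integral_less)
      show "AE x in M. 1 \<le> h x" using gt by eventually_elim auto
      show "\<not> (AE x in M. h x \<le> 1)"
      proof
        assume "AE x in M. h x \<le> 1"
        with gt have "AE x in M. False" by eventually_elim auto
        then show False by simp
      qed
    qed (auto simp: one)
    then show ?thesis using tot one by simp
  qed
  moreover have "AE x in M. 1 \<le> h x"
  proof (rule ccontr)
    assume "\<not> (AE x in M. 1 \<le> h x)"
    then have "(\<integral>\<^sup>+x. h x \<partial>M) < (\<integral>\<^sup>+x. 1 \<partial>M)"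
      using calculation tot by (intro nn_integral_less) auto
    then show False using tot one by simp
  qed
  ultimately have "AE x in M. h x = 1" by eventually_elim auto
  then have "density M h = density M (\<lambda>_. 1)" by (intro density_cong) auto
  then show ?thesis by (simp add: dens density_1)
qed

subsection \<open>Ergodicity\<close>

lemma simple_for_commute: "simple_for a b N \<Longrightarrow> simple_for b a N"
  unfolding simple_for_def allowable_def by blast

text \<open>Write N = (a + 1) q, where q is the least digit. Allowability at a point with digit q
  yields b < q, which is the required inequality after multiplication by a + 1.\<close>

lemma simple_for_branches:
  assumes "simple_for a b N"
  shows "branches a b N"
proof
  have N0: "N > 0" and all: "allowable a b N" and d: "a \<noteq> 0 \<Longrightarrow> a dvd N" "a \<noteq> 0 \<Longrightarrow> a + 1 dvd N"
    using assms by (auto simp: simple_for_def)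
  show "a \<noteq> 0 \<Longrightarrow> a dvd N" by (rule d)
  show Sd: "a + 1 dvd N" using d(2) by (cases "a = 0") auto
  then obtain q where q: "N = (a + 1) * q" by auto
  have q0: "q > 0" using N0 q by (auto intro!: gr0I)
  have aq: "a \<le> q"
  proof (cases "a = 0")
    case False
    have "coprime a (a + 1)" by simp
    with d(1)[OF False] have "a dvd q" unfolding q by (metis coprime_dvd_mult_right_iff)
    then show ?thesis using q0 by (rule dvd_imp_le)
  qed simp
  \<comment> \<open>The point a + 1 itself is outside the half-open interval, so q + 1/2 replaces q;
    the floor of N / x is still q. That x \<ge> a follows from a \<le> q, a consequence of the
    coprimality of a and a + 1.\<close>
  define x where "x = real N / (real q + 1/2)"
  have "real a * (real q + 1/2) \<le> (real a + 1) * real q"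
    using aq by (simp add: algebra_simps)
  then have "real a \<le> x" "x < real a + 1"
    using q0 unfolding x_def q by (auto simp: pos_le_divide_eq pos_divide_less_eq algebra_simps)
  moreover have "x > 0" using N0 by (simp add: x_def add_pos_pos)
  ultimately have "\<lfloor>real N / x\<rfloor> - int b > 0"
    using all by (auto simp: allowable_def unit_interval_at_def)
  moreover have "real N / x = real q + 1/2" using N0 by (simp add: x_def)
  moreover have "\<lfloor>real q + 1/2\<rfloor> = int q" by (rule floor_unique) auto
  ultimately have "b + 1 \<le> q" by simp
  then show "(a + 1) * (b + 1) \<le> N" unfolding q by (rule mult_le_mono2)
qed

lemma (in branches) transfer_op_cong:
  assumes "\<And>x. x \<in> open_unit a \<Longrightarrow> f x = g x" "y \<in> open_unit b"
  shows "transfer_op a b N f y = transfer_op a b N g y"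
  unfolding transfer_op_def using assms branch_mem by (intro suminf_cong) auto

lemma open_unit_measurable [measurable]: "open_unit a \<in> sets borel"
  by (simp add: open_unit_def)

lemma emeasure_open_unit: "emeasure lborel (open_unit a) = 1"
  by (simp add: open_unit_def)

lemma open_unit_disjoint:
  assumes "a \<noteq> b" "x \<in> open_unit a"
  shows "x \<notin> open_unit b" "x \<notin> unit_interval_at b"
proof -
  have "real a + 1 \<le> real b \<or> real b + 1 \<le> real a"
    using assms(1) by linarith
  then show "x \<notin> open_unit b" "x \<notin> unit_interval_at b"
    using assms(2) by (auto simp: open_unit_def unit_interval_at_def)
qed

lemma open_unit_subset: "open_unit a \<subseteq> unit_interval_at a"
  by (auto simp: open_unit_def unit_interval_at_def)

lemma log_lipschitz_mono:
  assumes "log_lipschitz K S f" "K \<le> K'"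
  shows "log_lipschitz K' S f"
  unfolding log_lipschitz_def
proof (intro ballI)
  fix x y assume "x \<in> S" "y \<in> S"
  then have "f x \<le> ennreal (exp (K * log_dist x y)) * f y" using assms(1) by (simp add: log_lipschitz_def)
  also have "\<dots> \<le> ennreal (exp (K' * log_dist x y)) * f y"
    using assms(2) log_dist_nonneg by (intro mult_right_mono ennreal_leI) (auto intro!: mult_right_mono)
  finally show "f x \<le> ennreal (exp (K' * log_dist x y)) * f y" .
qed

text \<open>Points of a unit interval are at \<open>log_dist\<close> at most 2, so f at each point
  is at least exp (-2 K) times the integral of f. Integrating this over A gives the bound.\<close>

lemma log_lipschitz_integral_bound:
  assumes f: "log_lipschitz K (open_unit a) f" "0 \<le> K"
    and [measurable]: "f \<in> borel_measurable borel" "A \<in> sets borel"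
  shows "emeasure lborel (A \<inter> open_unit a) * (\<integral>\<^sup>+x. f x * indicator (open_unit a) x \<partial>lborel)
      \<le> ennreal (exp (2 * K)) * (\<integral>\<^sup>+x. f x * indicator (A \<inter> open_unit a) x \<partial>lborel)"
proof -
  let ?I = "\<integral>\<^sup>+x. f x * indicator (open_unit a) x \<partial>lborel"
  have *: "?I \<le> ennreal (exp (2 * K)) * f y" if y: "y \<in> open_unit a" for y
  proof -
    have "?I \<le> (\<integral>\<^sup>+x. (ennreal (exp (2 * K)) * f y) * indicator (open_unit a) x \<partial>lborel)"
    proof (intro nn_integral_mono)
      fix x
      show "f x * indicator (open_unit a) x \<le> (ennreal (exp (2 * K)) * f y) * indicator (open_unit a) x"
      proof (cases "x \<in> open_unit a")
        case True
        have "log_dist x y \<le> 2 * \<bar>x - y\<bar>" using True y by (intro log_dist_le) (auto simp: open_unit_def)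
        also have "\<dots> \<le> 2" using True y by (auto simp: open_unit_def abs_if)
        finally have "exp (K * log_dist x y) \<le> exp (2 * K)"
          using f(2) by (simp add: mult.commute[of 2] mult_left_mono)
        then have "ennreal (exp (K * log_dist x y)) * f y \<le> ennreal (exp (2 * K)) * f y"
          by (intro mult_right_mono ennreal_leI) auto
        moreover have "f x \<le> ennreal (exp (K * log_dist x y)) * f y"
          using f(1) True y by (simp add: log_lipschitz_def)
        ultimately show ?thesis using True by simp
      qed simp
    qed
    also have "\<dots> = ennreal (exp (2 * K)) * f y"
      by (simp add: nn_integral_cmult_indicator emeasure_open_unit)
    finally show ?thesis .
  qed
  have "emeasure lborel (A \<inter> open_unit a) * ?I = (\<integral>\<^sup>+y. ?I * indicator (A \<inter> open_unit a) y \<partial>lborel)"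
    by (subst nn_integral_cmult_indicator) (auto simp: mult.commute)
  also have "\<dots> \<le> (\<integral>\<^sup>+y. ennreal (exp (2 * K)) * (f y * indicator (A \<inter> open_unit a) y) \<partial>lborel)"
    using * by (intro nn_integral_mono) (auto simp: indicator_def)
  also have "\<dots> = ennreal (exp (2 * K)) * (\<integral>\<^sup>+y. f y * indicator (A \<inter> open_unit a) y \<partial>lborel)"
    by (rule nn_integral_cmult) measurable
  finally show ?thesis .
qed

lemma T_map_measurable [measurable]: "T_map a1 a2 N \<in> borel_measurable borel"
proof -
  have [measurable]: "unit_interval_at a1 \<in> sets borel" by (simp add: unit_interval_at_def)
  show ?thesis unfolding T_map_def[abs_def] by measurable
qed

section \<open>Both intervals together: the full transfer operator and invariant sets\<close>

locale simple_pair =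
  fixes a1 a2 N :: nat
  assumes neq: "a1 \<noteq> a2" and simple: "simple_for a1 a2 N"

sublocale simple_pair \<subseteq> br1: branches a1 a2 N
  using simple by (rule simple_for_branches)

sublocale simple_pair \<subseteq> br2: branches a2 a1 N
  using simple_for_commute[OF simple] by (rule simple_for_branches)

context simple_pair
begin

definition Om :: "real set" where
  "Om = open_unit a1 \<union> open_unit a2"

text \<open>T exchanges the two open intervals up to null sets, so the image of f on one interval
  depends only on f on the other. Values outside \<open>Om\<close> are immaterial.\<close>

definition pair_op :: "(real \<Rightarrow> ennreal) \<Rightarrow> real \<Rightarrow> ennreal" where
  "pair_op f y = (if y \<in> open_unit a1 then transfer_op a2 a1 N f y else transfer_op a1 a2 N f y)"

definition inv_dens :: "real \<Rightarrow> real" where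
  "inv_dens x = dens a2 N x * indicator (unit_interval_at a1) x + dens a1 N x * indicator (unit_interval_at a2) x"

lemma Om_measurable [measurable]: "Om \<in> sets borel"
  unfolding Om_def by measurable

lemma inv_dens_measurable [measurable]: "inv_dens \<in> borel_measurable borel"
proof -
  have [measurable]: "unit_interval_at a \<in> sets borel" for a by (simp add: unit_interval_at_def)
  show ?thesis unfolding inv_dens_def[abs_def] by measurable
qed

lemma pair_op_measurable [measurable]:
  assumes [measurable]: "f \<in> borel_measurable borel"
  shows "pair_op f \<in> borel_measurable borel"
  unfolding pair_op_def[abs_def] by measurable

lemma indicator_Om: "indicator Om x = (indicator (open_unit a1) x + indicator (open_unit a2) x :: 'a::semiring_1)"
  using open_unit_disjoint(1)[OF neq] by (auto simp: Om_def indicator_def)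

lemma inv_dens_eq:
  "x \<in> open_unit a1 \<Longrightarrow> inv_dens x = dens a2 N x"
  "x \<in> open_unit a2 \<Longrightarrow> inv_dens x = dens a1 N x"
  using open_unit_disjoint(2)[OF neq, of x] open_unit_disjoint(2)[OF neq[symmetric], of x]
    open_unit_subset[of a1] open_unit_subset[of a2]
  by (auto simp: inv_dens_def)

lemma inv_dens_pos: "x \<in> Omega a1 a2 \<Longrightarrow> 0 < inv_dens x"
  using dens_pos[of x N] br1.N_pos
  by (auto simp: Omega_def inv_dens_def unit_interval_at_def indicator_def add_pos_pos)

lemma inv_dens_nonneg: "0 \<le> inv_dens x"
  using inv_dens_pos[of x] by (cases "x \<in> Omega a1 a2") (auto simp: inv_dens_def Omega_def)

lemma T_map_eq:
  "x \<in> open_unit a1 \<Longrightarrow> T_map a1 a2 N x = real N / x - of_int \<lfloor>real N / x\<rfloor> + real a2"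
  "x \<in> open_unit a2 \<Longrightarrow> T_map a1 a2 N x = real N / x - of_int \<lfloor>real N / x\<rfloor> + real a1"
  using open_unit_disjoint(2)[OF neq[symmetric], of x] open_unit_subset[of a1]
  by (auto simp: T_map_def open_unit_def)

lemma nn_integral_T_map:
  assumes [measurable]: "f \<in> borel_measurable borel" "g \<in> borel_measurable borel"
  shows "(\<integral>\<^sup>+x. g (T_map a1 a2 N x) * f x * indicator (open_unit a1) x \<partial>lborel)
       = (\<integral>\<^sup>+y. g y * pair_op f y * indicator (open_unit a2) y \<partial>lborel)"
    and "(\<integral>\<^sup>+x. g (T_map a1 a2 N x) * f x * indicator (open_unit a2) x \<partial>lborel)
       = (\<integral>\<^sup>+y. g y * pair_op f y * indicator (open_unit a1) y \<partial>lborel)"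
proof -
  have "(\<integral>\<^sup>+x. g (T_map a1 a2 N x) * f x * indicator (open_unit a1) x \<partial>lborel)
     = (\<integral>\<^sup>+x. g (real N / x - of_int \<lfloor>real N / x\<rfloor> + real a2) * f x * indicator (open_unit a1) x \<partial>lborel)"
    by (intro nn_integral_cong) (auto simp: T_map_eq indicator_def)
  also have "\<dots> = (\<integral>\<^sup>+y. g y * pair_op f y * indicator (open_unit a2) y \<partial>lborel)"
    unfolding br1.nn_integral_transfer_op[OF assms]
    using open_unit_disjoint(1)[OF neq]
    by (intro nn_integral_cong) (auto simp: pair_op_def indicator_def)
  finally show "(\<integral>\<^sup>+x. g (T_map a1 a2 N x) * f x * indicator (open_unit a1) x \<partial>lborel)
       = (\<integral>\<^sup>+y. g y * pair_op f y * indicator (open_unit a2) y \<partial>lborel)" .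
  have "(\<integral>\<^sup>+x. g (T_map a1 a2 N x) * f x * indicator (open_unit a2) x \<partial>lborel)
     = (\<integral>\<^sup>+x. g (real N / x - of_int \<lfloor>real N / x\<rfloor> + real a1) * f x * indicator (open_unit a2) x \<partial>lborel)"
    by (intro nn_integral_cong) (auto simp: T_map_eq indicator_def)
  also have "\<dots> = (\<integral>\<^sup>+y. g y * pair_op f y * indicator (open_unit a1) y \<partial>lborel)"
    unfolding br2.nn_integral_transfer_op[OF assms]
    by (intro nn_integral_cong) (auto simp: pair_op_def indicator_def)
  finally show "(\<integral>\<^sup>+x. g (T_map a1 a2 N x) * f x * indicator (open_unit a2) x \<partial>lborel)
       = (\<integral>\<^sup>+y. g y * pair_op f y * indicator (open_unit a1) y \<partial>lborel)" .
qed

lemma nn_integral_Om: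
  assumes [measurable]: "f \<in> borel_measurable borel"
  shows "(\<integral>\<^sup>+x. f x * indicator Om x \<partial>lborel) = (\<integral>\<^sup>+x. f x * indicator (open_unit a1) x \<partial>lborel)
      + (\<integral>\<^sup>+x. f x * indicator (open_unit a2) x \<partial>lborel)"
  unfolding indicator_Om by (simp add: distrib_left nn_integral_add)

lemma nn_integral_T_map_Om:
  assumes [measurable]: "f \<in> borel_measurable borel" "g \<in> borel_measurable borel"
  shows "(\<integral>\<^sup>+x. g (T_map a1 a2 N x) * f x * indicator Om x \<partial>lborel)
       = (\<integral>\<^sup>+y. g y * pair_op f y * indicator Om y \<partial>lborel)"
  by (subst (1 2) nn_integral_Om) (auto simp: nn_integral_T_map add.commute)

lemma pair_op_inv_dens:
  assumes "y \<in> Om"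
  shows "pair_op (\<lambda>x. ennreal (inv_dens x)) y = ennreal (inv_dens y)"
proof (cases "y \<in> open_unit a1")
  case True
  then have "pair_op (\<lambda>x. ennreal (inv_dens x)) y = transfer_op a2 a1 N (\<lambda>x. ennreal (dens a1 N x)) y"
    unfolding pair_op_def using True by (auto intro!: br2.transfer_op_cong simp: inv_dens_eq)
  then show ?thesis using br2.transfer_op_dens[OF True] inv_dens_eq(1)[OF True] by simp
next
  case False
  then have y: "y \<in> open_unit a2" using assms by (simp add: Om_def)
  then have "pair_op (\<lambda>x. ennreal (inv_dens x)) y = transfer_op a1 a2 N (\<lambda>x. ennreal (dens a2 N x)) y"
    unfolding pair_op_def using False by (auto intro!: br1.transfer_op_cong simp: inv_dens_eq)
  then show ?thesis using br1.transfer_op_dens[OF y] inv_dens_eq(2)[OF y] by simp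
qed

text \<open>The larger of the two contraction factors, one for each target interval.\<close>

definition \<beta> :: real where
  "\<beta> = max ((real a1 + 3/2) / (real a1 + 2)) ((real a2 + 3/2) / (real a2 + 2))"

lemma \<beta>: "0 < \<beta>" "\<beta> < 1"
  by (auto simp: \<beta>_def less_max_iff_disj)

lemma log_lipschitz_pair_op:
  assumes "log_lipschitz K (open_unit a1) f" "log_lipschitz K (open_unit a2) f" "0 \<le> K"
  shows "log_lipschitz (\<beta> * K + 2) (open_unit a1) (pair_op f)"
    "log_lipschitz (\<beta> * K + 2) (open_unit a2) (pair_op f)"
proof -
  have "log_lipschitz (\<beta> * K + 2) (open_unit a1) (transfer_op a2 a1 N f)"
    by (rule br2.log_lipschitz_transfer_op) (use assms in \<open>auto simp: \<beta>_def\<close>)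
  then show "log_lipschitz (\<beta> * K + 2) (open_unit a1) (pair_op f)"
    by (simp add: log_lipschitz_def pair_op_def)
  have "log_lipschitz (\<beta> * K + 2) (open_unit a2) (transfer_op a1 a2 N f)"
    by (rule br1.log_lipschitz_transfer_op) (use assms in \<open>auto simp: \<beta>_def\<close>)
  then show "log_lipschitz (\<beta> * K + 2) (open_unit a2) (pair_op f)"
    using open_unit_disjoint(1)[OF neq] by (fastforce simp: log_lipschitz_def pair_op_def)
qed

text \<open>The constants obey K \<mapsto> \<beta> K + 2, whose fixed point is 2 / (1 - \<beta>);
  the influence of the initial K decays geometrically.\<close>

lemma log_lipschitz_pair_op_iterate:
  assumes "log_lipschitz K (open_unit a1) f" "log_lipschitz K (open_unit a2) f" "0 \<le> K"
  shows "log_lipschitz (\<beta> ^ n * K + 2 / (1 - \<beta>)) (open_unit a1) ((pair_op ^^ n) f) \<and>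
     log_lipschitz (\<beta> ^ n * K + 2 / (1 - \<beta>)) (open_unit a2) ((pair_op ^^ n) f)"
proof (induction n)
  case 0
  have "K \<le> K + 2 / (1 - \<beta>)" using \<beta> by simp
  then show ?case using assms(1,2) by (auto intro: log_lipschitz_mono)
next
  case (Suc n)
  have nn: "0 \<le> \<beta> ^ n * K + 2 / (1 - \<beta>)" using \<beta> assms(3) by simp
  have "\<beta> * (\<beta> ^ n * K + 2 / (1 - \<beta>)) + 2 = \<beta> ^ Suc n * K + 2 / (1 - \<beta>)"
    using \<beta> by (simp add: field_simps)
  then show ?case using log_lipschitz_pair_op[of "\<beta> ^ n * K + 2 / (1 - \<beta>)" "(pair_op ^^ n) f"] Suc nn by simp
qed

text \<open>Iterating the transfer operator makes the log-Lipschitz constant independent of \<open>f\<close>, while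
  its integral over an invariant set stays the same.\<close>

lemma invariant_set_lower_bound:
  assumes f: "log_lipschitz K (open_unit a1) f" "log_lipschitz K (open_unit a2) f" "0 \<le> K"
    and [measurable]: "f \<in> borel_measurable borel" "A \<in> sets borel"
    and inv: "\<And>x. x \<in> Om \<Longrightarrow> T_map a1 a2 N x \<in> A \<longleftrightarrow> x \<in> A"
  shows "min (emeasure lborel (A \<inter> open_unit a1)) (emeasure lborel (A \<inter> open_unit a2))
        * (\<integral>\<^sup>+x. f x * indicator Om x \<partial>lborel)
      \<le> ennreal (exp (2 * (1 + 2 / (1 - \<beta>)))) * (\<integral>\<^sup>+x. indicator A x * f x * indicator Om x \<partial>lborel)"
proof -
  let ?K = "1 + 2 / (1 - \<beta>)"
  have K: "0 \<le> ?K" using \<beta> by simp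
  define F where "F n = (pair_op ^^ n) f" for n
  have F_Suc: "F (Suc n) = pair_op (F n)" for n by (simp add: F_def)
  have F [measurable]: "F n \<in> borel_measurable borel" for n
  proof (induction n)
    case (Suc n)
    from pair_op_measurable[OF this] show ?case by (simp only: F_Suc)
  qed (simp add: F_def)
  \<comment> \<open>Duality tested against the indicator of an invariant set. It is used for A and,
    with B = \<open>UNIV\<close>, for the total integral.\<close>
  have int_inv: "(\<integral>\<^sup>+x. indicator B x * F n x * indicator Om x \<partial>lborel) = (\<integral>\<^sup>+x. indicator B x * f x * indicator Om x \<partial>lborel)"
    if [measurable]: "B \<in> sets borel" and B: "\<And>x. x \<in> Om \<Longrightarrow> T_map a1 a2 N x \<in> B \<longleftrightarrow> x \<in> B" for B n
  proof (induction n)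
    case (Suc n)
    have "(\<integral>\<^sup>+x. indicator B x * F (Suc n) x * indicator Om x \<partial>lborel)
        = (\<integral>\<^sup>+x. indicator B (T_map a1 a2 N x) * F n x * indicator Om x \<partial>lborel)"
      by (subst nn_integral_T_map_Om) (auto simp: F_Suc)
    also have "\<dots> = (\<integral>\<^sup>+x. indicator B x * F n x * indicator Om x \<partial>lborel)"
      using B by (intro nn_integral_cong) (auto simp: indicator_def)
    finally show ?case using Suc by simp
  qed (simp add: F_def)
  \<comment> \<open>After n iterations the constant is below 1 + 2 / (1 - \<beta>), whatever K
    was.\<close>
  have "\<exists>n. K * \<beta> ^ n < 1"
  proof -
    have "(\<lambda>n. K * \<beta> ^ n) \<longlonglongrightarrow> K * 0" using \<beta> by (intro tendsto_intros LIMSEQ_power_zero) auto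
    then have "eventually (\<lambda>n. K * \<beta> ^ n < 1) sequentially" by (rule order_tendstoD) simp
    then show ?thesis by (auto simp: eventually_sequentially)
  qed
  then obtain n where n: "K * \<beta> ^ n < 1" by blast
  have lip: "log_lipschitz ?K (open_unit a1) (F n)" "log_lipschitz ?K (open_unit a2) (F n)"
    using log_lipschitz_pair_op_iterate[OF f, of n] n unfolding F_def
    by (auto elim!: log_lipschitz_mono simp: mult.commute)
  let ?m = "min (emeasure lborel (A \<inter> open_unit a1)) (emeasure lborel (A \<inter> open_unit a2))"
  have "?m * (\<integral>\<^sup>+x. f x * indicator Om x \<partial>lborel) = ?m * (\<integral>\<^sup>+x. F n x * indicator Om x \<partial>lborel)"
    using int_inv[of UNIV n] by simp
  also have "\<dots> = ?m * (\<integral>\<^sup>+x. F n x * indicator (open_unit a1) x \<partial>lborel)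
      + ?m * (\<integral>\<^sup>+x. F n x * indicator (open_unit a2) x \<partial>lborel)"
    by (simp add: nn_integral_Om distrib_left)
  also have "\<dots> \<le> emeasure lborel (A \<inter> open_unit a1) * (\<integral>\<^sup>+x. F n x * indicator (open_unit a1) x \<partial>lborel)
      + emeasure lborel (A \<inter> open_unit a2) * (\<integral>\<^sup>+x. F n x * indicator (open_unit a2) x \<partial>lborel)"
    by (intro add_mono mult_right_mono) auto
  also have "\<dots> \<le> ennreal (exp (2 * ?K)) * (\<integral>\<^sup>+x. F n x * indicator (A \<inter> open_unit a1) x \<partial>lborel)
      + ennreal (exp (2 * ?K)) * (\<integral>\<^sup>+x. F n x * indicator (A \<inter> open_unit a2) x \<partial>lborel)"
    by (intro add_mono log_lipschitz_integral_bound lip K) auto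
  also have "\<dots> = ennreal (exp (2 * ?K)) * (\<integral>\<^sup>+x. (indicator A x * F n x) * indicator Om x \<partial>lborel)"
    by (subst nn_integral_Om) (auto simp: distrib_left indicator_inter_arith mult_ac)
  also have "\<dots> = ennreal (exp (2 * ?K)) * (\<integral>\<^sup>+x. indicator A x * f x * indicator Om x \<partial>lborel)"
    by (subst int_inv) (simp_all add: inv)
  finally show ?thesis .
qed

text \<open>T carries the measure with density \<open>inv_dens\<close> from the first interval to
  the second, so both pieces of an invariant set have equal mass for it; positivity of the density
  transfers this to Lebesgue null sets. It handles the minimum in
  \<open>invariant_set_lower_bound\<close>.\<close>

lemma invariant_set_null_pieces:
  assumes [measurable]: "A \<in> sets borel"
    and inv: "\<And>x. x \<in> Om \<Longrightarrow> T_map a1 a2 N x \<in> A \<longleftrightarrow> x \<in> A"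
  shows "emeasure lborel (A \<inter> open_unit a1) = 0 \<longleftrightarrow> emeasure lborel (A \<inter> open_unit a2) = 0"
proof -
  have *: "emeasure lborel (A \<inter> open_unit a) = 0 \<longleftrightarrow>
      (\<integral>\<^sup>+x. indicator A x * ennreal (inv_dens x) * indicator (open_unit a) x \<partial>lborel) = 0"
    if a: "a \<in> {a1, a2}" for a
  proof -
    have pos: "0 < inv_dens x" if "x \<in> open_unit a" for x
      using that a open_unit_subset[of a] by (intro inv_dens_pos) (auto simp: Omega_def)
    have "(\<integral>\<^sup>+x. indicator A x * ennreal (inv_dens x) * indicator (open_unit a) x \<partial>lborel) = 0
        \<longleftrightarrow> (AE x in lborel. indicator A x * ennreal (inv_dens x) * indicator (open_unit a) x = 0)"
      by (rule nn_integral_0_iff_AE) measurable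
    also have "\<dots> \<longleftrightarrow> (AE x in lborel. x \<notin> A \<inter> open_unit a)"
      by (intro AE_cong) (auto simp: indicator_def ennreal_eq_0_iff not_le dest: pos)
    also have "\<dots> \<longleftrightarrow> emeasure lborel (A \<inter> open_unit a) = 0"
      by (rule AE_iff_measurable) auto
    finally show ?thesis by simp
  qed
  have "(\<integral>\<^sup>+x. indicator A x * ennreal (inv_dens x) * indicator (open_unit a1) x \<partial>lborel)
      = (\<integral>\<^sup>+x. indicator A (T_map a1 a2 N x) * ennreal (inv_dens x) * indicator (open_unit a1) x \<partial>lborel)"
    using inv by (intro nn_integral_cong) (auto simp: indicator_def Om_def)
  also have "\<dots> = (\<integral>\<^sup>+x. indicator A x * pair_op (\<lambda>x. ennreal (inv_dens x)) x * indicator (open_unit a2) x \<partial>lborel)"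
    by (rule nn_integral_T_map) auto
  also have "\<dots> = (\<integral>\<^sup>+x. indicator A x * ennreal (inv_dens x) * indicator (open_unit a2) x \<partial>lborel)"
    by (intro nn_integral_cong) (auto simp: indicator_def Om_def pair_op_inv_dens)
  finally show ?thesis using * by simp
qed

text \<open>The distance to S is 1-Lipschitz, and \<open>abs_diff_le_log_dist\<close> with bound a +
  1 supplies the factor a + 3/2.\<close>

lemma log_lipschitz_exp_infdist:
  assumes "0 \<le> c"
  shows "\<exists>K\<ge>0. log_lipschitz K (open_unit a) (\<lambda>x. ennreal (exp (- c * infdist x S)))"
proof (intro exI conjI)
  show "0 \<le> c * (real a + 3/2)" using assms by simp
  show "log_lipschitz (c * (real a + 3/2)) (open_unit a) (\<lambda>x. ennreal (exp (- c * infdist x S)))"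
    unfolding log_lipschitz_def
  proof (intro ballI)
    fix x y assume xy: "x \<in> open_unit a" "y \<in> open_unit a"
    have "infdist y S - infdist x S \<le> dist y x" using infdist_triangle[of y S x] by simp
    also have "\<dots> = \<bar>x - y\<bar>" by (simp add: dist_real_def)
    also have "\<dots> \<le> (real a + 1 + 1/2) * log_dist x y"
      by (rule abs_diff_le_log_dist) (use xy in \<open>auto simp: open_unit_def\<close>)
    finally have "infdist y S - infdist x S \<le> (real a + 3/2) * log_dist x y" by (simp add: add_ac)
    then have "c * (infdist y S - infdist x S) \<le> c * ((real a + 3/2) * log_dist x y)"
      using assms by (rule mult_left_mono)
    then have "exp (- c * infdist x S) \<le> exp (c * (real a + 3/2) * log_dist x y) * exp (- c * infdist y S)"
      by (simp add: algebra_simps flip: exp_add)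
    then show "ennreal (exp (- c * infdist x S))
        \<le> ennreal (exp (c * (real a + 3/2) * log_dist x y)) * ennreal (exp (- c * infdist y S))"
      by (simp flip: ennreal_mult)
  qed
qed

lemma invariant_set_trivial:
  assumes A [measurable]: "A \<in> sets borel"
    and inv: "\<And>x. x \<in> Om \<Longrightarrow> T_map a1 a2 N x \<in> A \<longleftrightarrow> x \<in> A"
  shows "emeasure lborel (A \<inter> Om) = 0 \<or> emeasure lborel (Om - A) = 0"
proof (rule disjCI)
  assume "emeasure lborel (Om - A) \<noteq> 0"
  define m where "m = min (emeasure lborel (A \<inter> open_unit a1)) (emeasure lborel (A \<inter> open_unit a2))"
  define c where "c = exp (2 * (1 + 2 / (1 - \<beta>)))"
  have fin: "emeasure lborel (Om \<inter> B) < \<infinity>" for B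
  proof -
    have "emeasure lborel (Om \<inter> B) \<le> emeasure lborel (open_unit a1 \<union> open_unit a2)"
      by (intro emeasure_mono) (auto simp: Om_def)
    also have "\<dots> \<le> emeasure lborel (open_unit a1) + emeasure lborel (open_unit a2)"
      by (rule emeasure_subadditive) auto
    also have "\<dots> < \<infinity>" by (simp add: emeasure_open_unit)
    finally show ?thesis .
  qed
  \<comment> \<open>S must be nonempty because \<open>infdist x {}\<close> is 0 by convention, and
    then the functions below would not decay off S.\<close>
  have closed_null: "m * emeasure lborel S = 0" if S: "closed S" "S \<subseteq> Om - A" "S \<noteq> {}" for S
  proof -
    have [measurable]: "S \<in> sets borel" using S(1) by (rule borel_closed)
    define f where "f n x = ennreal (exp (- real n * infdist x S))" for n x
    have [measurable]: "f n \<in> borel_measurable borel" for n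
      unfolding f_def[abs_def]
      by (intro measurable_compose[OF _ measurable_ennreal] borel_measurable_continuous_onI continuous_intros)
    have le: "m * emeasure lborel S \<le> ennreal c * (\<integral>\<^sup>+x. indicator A x * f n x * indicator Om x \<partial>lborel)" for n
    proof -
      obtain K1 K2 where K: "0 \<le> K1" "log_lipschitz K1 (open_unit a1) (f n)"
          "0 \<le> K2" "log_lipschitz K2 (open_unit a2) (f n)"
        using log_lipschitz_exp_infdist[of "real n" _ S] unfolding f_def by (metis of_nat_0_le_iff)
      have "emeasure lborel S = (\<integral>\<^sup>+x. indicator S x \<partial>lborel)" by simp
      also have "\<dots> \<le> (\<integral>\<^sup>+x. f n x * indicator Om x \<partial>lborel)"
        using S by (intro nn_integral_mono) (auto simp: indicator_def f_def)
      finally have "m * emeasure lborel S \<le> m * (\<integral>\<^sup>+x. f n x * indicator Om x \<partial>lborel)"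
        by (rule mult_left_mono) simp
      also have "\<dots> \<le> ennreal c * (\<integral>\<^sup>+x. indicator A x * f n x * indicator Om x \<partial>lborel)"
        unfolding m_def c_def
        using K by (intro invariant_set_lower_bound[of "max K1 K2"] inv) (auto elim: log_lipschitz_mono)
      finally show ?thesis .
    qed
    \<comment> \<open>The functions equal 1 on S but tend to 0 at every point of A, as S is closed
      and disjoint from A. The indicator of \<open>Om\<close> is an integrable majorant.\<close>
    have "(\<lambda>n. \<integral>\<^sup>+x. indicator A x * f n x * indicator Om x \<partial>lborel) \<longlonglongrightarrow> (\<integral>\<^sup>+x. 0 \<partial>(lborel :: real measure))"
    proof (rule nn_integral_dominated_convergence[where w = "indicator (Om \<inter> UNIV)"])
      show "AE x in lborel. indicator A x * f n x * indicator Om x \<le> indicator (Om \<inter> UNIV) x" for n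
        by (intro AE_I2) (auto simp: indicator_def f_def intro!: mult_nonneg_nonneg infdist_nonneg)
      show "(\<integral>\<^sup>+x. indicator (Om \<inter> UNIV) x \<partial>lborel) < \<infinity>"
        using fin[of UNIV] by simp
      show "AE x in lborel. (\<lambda>n. indicator A x * f n x * indicator Om x) \<longlonglongrightarrow> 0"
      proof (intro AE_I2)
        fix x
        show "(\<lambda>n. indicator A x * f n x * indicator Om x) \<longlonglongrightarrow> 0"
        proof (cases "x \<in> A \<and> x \<in> Om")
          case True
          then have "x \<notin> S" using S(2) by auto
          then have "infdist x S > 0"
            using S in_closed_iff_infdist_zero[of S x] infdist_nonneg[of x S] by linarith
          then have "(\<lambda>n. exp (- real n * infdist x S)) \<longlonglongrightarrow> 0" by real_asymp
          then have "(\<lambda>n. f n x) \<longlonglongrightarrow> 0" unfolding f_def by (simp add: tendsto_ennreal_iff flip: ennreal_0)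
          then show ?thesis using True by simp
        qed auto
      qed
    qed auto
    then have "(\<lambda>n. ennreal c * (\<integral>\<^sup>+x. indicator A x * f n x * indicator Om x \<partial>lborel)) \<longlonglongrightarrow> ennreal c * 0"
      by (intro ennreal_tendsto_cmult) auto
    then have "m * emeasure lborel S \<le> 0"
      by (intro LIMSEQ_le_const[of _ "0 :: ennreal"]) (auto intro: le)
    then show ?thesis by simp
  qed
  have "\<exists>S. closed S \<and> S \<subseteq> Om - A \<and> emeasure lborel S \<noteq> 0"
  proof (rule ccontr)
    assume no: "\<not> (\<exists>S. closed S \<and> S \<subseteq> Om - A \<and> emeasure lborel S \<noteq> 0)"
    let ?e = "enn2real (emeasure lborel (Om - A))"
    have e: "emeasure lborel (Om - A) = ennreal ?e" using fin[of "- A"] by (simp add: Diff_eq)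
    have "0 < ?e" using \<open>emeasure lborel (Om - A) \<noteq> 0\<close> e by (metis enn2real_nonneg ennreal_0 order_le_less)
    moreover have "Om - A \<in> sets lebesgue" by simp
    \<comment> \<open>Inner regularity with tolerance equal to the full mass of Om - A: what S
      leaves uncovered has strictly smaller mass, so S cannot be null.\<close>
    ultimately obtain S where S: "closed S" "S \<subseteq> Om - A" "emeasure lebesgue (Om - A - S) < ennreal ?e"
      by (metis sets_lebesgue_inner_closed)
    have [measurable]: "S \<in> sets borel" using S(1) by (rule borel_closed)
    have "S \<in> null_sets lborel" using no S by (auto simp: null_sets_def)
    then have "emeasure lborel (Om - A - S) = emeasure lborel (Om - A)" by (intro emeasure_Diff_null_set) auto
    then show False using S(3) e by simp
  qed
  then obtain S where S: "closed S" "S \<subseteq> Om - A" "emeasure lborel S \<noteq> 0" by blast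
  then have "m * emeasure lborel S = 0" by (intro closed_null) auto
  then have "m = 0" using S(3) by simp
  then have "emeasure lborel (A \<inter> open_unit a1) = 0 \<and> emeasure lborel (A \<inter> open_unit a2) = 0"
    using invariant_set_null_pieces[OF A inv] unfolding m_def min_def by (auto split: if_splits)
  then have "emeasure lborel ((A \<inter> open_unit a1) \<union> (A \<inter> open_unit a2)) = 0"
    using emeasure_subadditive[of "A \<inter> open_unit a1" lborel "A \<inter> open_unit a2"] by simp
  then show "emeasure lborel (A \<inter> Om) = 0" by (simp add: Om_def Int_Un_distrib)
qed

end

subsection \<open>The invariant measure\<close>

text \<open>The antiderivative is a difference of logarithms, and the four resulting terms combine
  to ln (n / d) with n = d + N. The value is symmetric in a and c, so both intervals have equal
  mass, whence the factor 2 in the normalizer.\<close>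

lemma nn_integral_dens:
  assumes "0 < N"
  shows "(\<integral>\<^sup>+x. ennreal (dens c N x) * indicator (open_unit a) x \<partial>lborel)
    = ennreal (ln (1 + real N / ((real N + real a * (real c + 1)) * (real N + real c * (real a + 1)))))"
proof -
  define F where "F x = ln (real N + (real c + 1) * x) - ln (real N + real c * x)" for x
  have pos: "0 < real N + (real c + 1) * x" "0 < real N + real c * x" if "0 \<le> x" for x
    using that assms by (simp_all add: add_pos_nonneg)
  have "(\<integral>\<^sup>+x. ennreal (dens c N x) * indicator (open_unit a) x \<partial>lborel)
      = (\<integral>\<^sup>+x. ennreal (dens c N x) * indicator {real a .. real a + 1} x \<partial>lborel)"
    using AE_lborel_singleton[of "real a"] AE_lborel_singleton[of "real a + 1"]
    by (intro nn_integral_cong_AE, eventually_elim) (auto simp: open_unit_def indicator_def)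
  also have "\<dots> = ennreal (F (real a + 1) - F (real a))"
  proof (rule nn_integral_FTC_Icc)
    fix x assume "x \<in> {real a .. real a + 1}"
    then have "0 \<le> x" by simp
    from pos[OF this] show "(F has_real_derivative dens c N x) (at x)"
      unfolding F_def dens_def by (auto intro!: derivative_eq_intros)
    show "0 \<le> dens c N x" using dens_pos[OF \<open>0 \<le> x\<close> assms, of c] by simp
  qed simp_all
  also have "F (real a + 1) - F (real a)
     = ln (1 + real N / ((real N + real a * (real c + 1)) * (real N + real c * (real a + 1))))"
  proof -
    let ?n = "(real N + (real c + 1) * (real a + 1)) * (real N + real c * real a)"
    let ?d = "(real N + real a * (real c + 1)) * (real N + real c * (real a + 1))"
    have p: "0 < real N + (real c + 1) * (real a + 1)" "0 < real N + real c * real a"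
       "0 < real N + real a * (real c + 1)" "0 < real N + real c * (real a + 1)"
      using pos[of "real a"] pos[of "real a + 1"] by (simp_all add: mult.commute)
    then have "F (real a + 1) - F (real a) = ln ?n - ln ?d"
      unfolding F_def by (simp add: ln_mult_pos mult.commute)
    also have "\<dots> = ln (?n / ?d)" using p by (subst ln_div) auto
    also have "?n = ?d + real N" by (simp add: algebra_simps)
    also have "(?d + real N) / ?d = 1 + real N / ?d" using p by (simp add: add_divide_distrib)
    finally show ?thesis .
  qed
  finally show ?thesis .
qed

section \<open>Normalization, invariance and ergodicity of the explicit measure\<close>

context simple_pair
begin

definition inv_measure :: "real measure" where
  "inv_measure = density (restrict_space lborel (Omega a1 a2))
     (\<lambda>x. ennreal (inv_dens x) / (\<integral>\<^sup>+x. ennreal (inv_dens x) * indicator Om x \<partial>lborel))"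

lemma Omega_measurable [measurable]: "Omega a1 a2 \<in> sets borel"
  by (simp add: Omega_def unit_interval_at_def)

lemma sets_inv_measure: "sets inv_measure = sets (borel_Omega a1 a2)"
  by (simp add: inv_measure_def borel_Omega_def cong: sets_restrict_space_cong)

lemma space_inv_measure: "space inv_measure = Omega a1 a2"
  by (simp add: inv_measure_def space_restrict_space)

lemma sets_borel_Omega: "A \<in> sets (borel_Omega a1 a2) \<longleftrightarrow> A \<in> sets borel \<and> A \<subseteq> Omega a1 a2"
  by (auto simp: borel_Omega_def sets_restrict_space_iff)

lemma AE_Om: "AE x in lborel. x \<in> Om \<longleftrightarrow> x \<in> Omega a1 a2"
  using AE_lborel_singleton[of "real a1"] AE_lborel_singleton[of "real a2"]
  by eventually_elim (auto simp: Om_def Omega_def open_unit_def unit_interval_at_def)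

lemma nn_integral_inv_dens:
  "(\<integral>\<^sup>+x. ennreal (inv_dens x) * indicator Om x \<partial>lborel) = ennreal (2 * ln (1 + real N /
      ((real N + real a1 * (real a2 + 1)) * (real N + real a2 * (real a1 + 1)))))" (is "_ = ennreal (2 * ln ?r)")
proof -
  have "(\<integral>\<^sup>+x. ennreal (inv_dens x) * indicator (open_unit a1) x \<partial>lborel)
      = (\<integral>\<^sup>+x. ennreal (dens a2 N x) * indicator (open_unit a1) x \<partial>lborel)"
    by (intro nn_integral_cong) (auto simp: inv_dens_eq indicator_def)
  also have "\<dots> = ennreal (ln ?r)" by (rule nn_integral_dens[OF br1.N_pos])
  finally have 1: "(\<integral>\<^sup>+x. ennreal (inv_dens x) * indicator (open_unit a1) x \<partial>lborel) = ennreal (ln ?r)" .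
  have "(\<integral>\<^sup>+x. ennreal (inv_dens x) * indicator (open_unit a2) x \<partial>lborel)
      = (\<integral>\<^sup>+x. ennreal (dens a1 N x) * indicator (open_unit a2) x \<partial>lborel)"
    by (intro nn_integral_cong) (auto simp: inv_dens_eq indicator_def)
  also have "\<dots> = ennreal (ln ?r)" unfolding nn_integral_dens[OF br1.N_pos] by (simp only: mult.commute)
  finally have 2: "(\<integral>\<^sup>+x. ennreal (inv_dens x) * indicator (open_unit a2) x \<partial>lborel) = ennreal (ln ?r)" .
  have "0 \<le> ln ?r" by (intro ln_ge_zero) simp
  then show ?thesis by (simp add: nn_integral_Om 1 2 flip: ennreal_plus)
qed

lemma normalizer_pos:
  "0 < 2 * ln (1 + real N / ((real N + real a1 * (real a2 + 1)) * (real N + real a2 * (real a1 + 1))))"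
proof -
  have "0 < real N / ((real N + real a1 * (real a2 + 1)) * (real N + real a2 * (real a1 + 1)))"
    using br1.N_pos by (simp add: add_pos_nonneg)
  then show ?thesis by (simp add: ln_gt_zero)
qed

abbreviation "Z \<equiv> \<integral>\<^sup>+x. ennreal (inv_dens x) * indicator Om x \<partial>lborel"

lemma Z: "Z \<noteq> 0" "Z \<noteq> \<infinity>"
  using normalizer_pos by (simp_all add: nn_integral_inv_dens)

lemma emeasure_inv_measure:
  assumes "A \<in> sets (borel_Omega a1 a2)"
  shows "emeasure inv_measure A = (\<integral>\<^sup>+x. indicator A x * ennreal (inv_dens x) * indicator Om x \<partial>lborel) / Z"
proof -
  have A [measurable]: "A \<in> sets borel" and sub: "A \<subseteq> Omega a1 a2"
    using assms by (auto simp: sets_borel_Omega)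
  have "emeasure inv_measure A = (\<integral>\<^sup>+x. (ennreal (inv_dens x) / Z) * indicator A x \<partial>restrict_space lborel (Omega a1 a2))"
    unfolding inv_measure_def
    by (intro emeasure_density measurable_restrict_space1) (auto simp: sets_restrict_space_iff sub)
  also have "\<dots> = (\<integral>\<^sup>+x. (ennreal (inv_dens x) / Z) * indicator A x * indicator (Omega a1 a2) x \<partial>lborel)"
    by (intro nn_integral_restrict_space) auto
  also have "\<dots> = (\<integral>\<^sup>+x. (indicator A x * ennreal (inv_dens x) * indicator Om x) / Z \<partial>lborel)"
    using AE_Om by (intro nn_integral_cong_AE, eventually_elim) (use sub in \<open>auto simp: indicator_def\<close>)
  also have "\<dots> = (\<integral>\<^sup>+x. indicator A x * ennreal (inv_dens x) * indicator Om x \<partial>lborel) / Z"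
    by (rule nn_integral_divide) measurable
  finally show ?thesis .
qed

lemma prob_space_inv_measure: "prob_space inv_measure"
proof
  have "emeasure inv_measure (Omega a1 a2)
     = (\<integral>\<^sup>+x. indicator (Omega a1 a2) x * ennreal (inv_dens x) * indicator Om x \<partial>lborel) / Z"
    by (rule emeasure_inv_measure) (simp add: sets_borel_Omega)
  also have "\<dots> = Z / Z"
    by (intro arg_cong2[where f = "(/)"] nn_integral_cong refl)
       (use open_unit_subset in \<open>auto simp: indicator_def Om_def Omega_def\<close>)
  also have "\<dots> = 1" using Z by (simp add: ennreal_divide_self less_top)
  finally show "emeasure inv_measure (space inv_measure) = 1" by (simp add: space_inv_measure)
qed

lemma T_map_Omega:
  assumes "x \<in> Omega a1 a2"
  shows "T_map a1 a2 N x \<in> Omega a1 a2"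
  using assms unfolding T_map_def Omega_def unit_interval_at_def
  by (auto simp: algebra_simps) linarith+

text \<open>Duality against the indicator of A replaces composition with T by the transfer operator,
  and \<open>pair_op\<close> fixes \<open>inv_dens\<close> on \<open>Om\<close>.\<close>

lemma invariant_inv_measure: "invariant_measure (T_map a1 a2 N) inv_measure"
proof -
  have meas: "T_map a1 a2 N \<in> measurable inv_measure inv_measure"
  proof -
    have "T_map a1 a2 N \<in> measurable (borel_Omega a1 a2) (borel_Omega a1 a2)"
      unfolding borel_Omega_def using T_map_Omega
      by (intro measurable_restrict_space2 measurable_restrict_space1)
         (auto simp: space_restrict_space)
    then show ?thesis by (simp cong: measurable_cong_sets add: sets_inv_measure)
  qed
  have "distr inv_measure inv_measure (T_map a1 a2 N) = inv_measure"
  proof (rule measure_eqI)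
    fix A assume "A \<in> sets (distr inv_measure inv_measure (T_map a1 a2 N))"
    then have A': "A \<in> sets inv_measure" by simp
    then have A: "A \<in> sets (borel_Omega a1 a2)" by (simp add: sets_inv_measure)
    then have [measurable]: "A \<in> sets borel" by (simp add: sets_borel_Omega)
    have pre: "T_map a1 a2 N -` A \<inter> Omega a1 a2 \<in> sets (borel_Omega a1 a2)"
      using measurable_sets[OF meas A'] by (simp add: space_inv_measure sets_inv_measure)
    have "emeasure (distr inv_measure inv_measure (T_map a1 a2 N)) A
        = emeasure inv_measure (T_map a1 a2 N -` A \<inter> Omega a1 a2)"
      using emeasure_distr[OF meas A'] by (simp add: space_inv_measure)
    also have "\<dots> = (\<integral>\<^sup>+x. indicator (T_map a1 a2 N -` A \<inter> Omega a1 a2) x * ennreal (inv_dens x) * indicator Om x \<partial>lborel) / Z"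
      by (rule emeasure_inv_measure[OF pre])
    also have "(\<integral>\<^sup>+x. indicator (T_map a1 a2 N -` A \<inter> Omega a1 a2) x * ennreal (inv_dens x) * indicator Om x \<partial>lborel)
        = (\<integral>\<^sup>+x. indicator A (T_map a1 a2 N x) * ennreal (inv_dens x) * indicator Om x \<partial>lborel)"
      using open_unit_subset by (intro nn_integral_cong) (auto simp: indicator_def Om_def Omega_def)
    also have "\<dots> = (\<integral>\<^sup>+x. indicator A x * pair_op (\<lambda>x. ennreal (inv_dens x)) x * indicator Om x \<partial>lborel)"
      by (rule nn_integral_T_map_Om) auto
    also have "\<dots> = (\<integral>\<^sup>+x. indicator A x * ennreal (inv_dens x) * indicator Om x \<partial>lborel)"
      by (intro nn_integral_cong) (auto simp: indicator_def pair_op_inv_dens)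
    finally show "emeasure (distr inv_measure inv_measure (T_map a1 a2 N)) A = emeasure inv_measure A"
      by (simp add: emeasure_inv_measure[OF A])
  qed simp
  with meas show ?thesis by (simp add: invariant_measure_def)
qed

lemma ergodic_inv_measure: "ergodic_measure (T_map a1 a2 N) inv_measure"
  unfolding ergodic_measure_def
proof (intro ballI impI)
  fix A assume A': "A \<in> sets inv_measure" and inv: "T_map a1 a2 N -` A \<inter> space inv_measure = A"
  then have A: "A \<in> sets (borel_Omega a1 a2)" by (simp add: sets_inv_measure)
  then have m [measurable]: "A \<in> sets borel" by (simp add: sets_borel_Omega)
  have sub: "Om \<subseteq> Omega a1 a2" using open_unit_subset by (auto simp: Om_def Omega_def)
  have "emeasure lborel (A \<inter> Om) = 0 \<or> emeasure lborel (Om - A) = 0"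
    using inv sub by (intro invariant_set_trivial) (auto simp: space_inv_measure)
  then have "emeasure inv_measure A = 0 \<or> emeasure inv_measure A = 1"
  proof
    assume "emeasure lborel (A \<inter> Om) = 0"
    then have "A \<inter> Om \<in> null_sets lborel" by (simp add: null_sets_def)
    from AE_not_in[OF this]
    have "(\<integral>\<^sup>+x. indicator A x * ennreal (inv_dens x) * indicator Om x \<partial>lborel) = (\<integral>\<^sup>+x. 0 \<partial>(lborel :: real measure))"
      by (intro nn_integral_cong_AE, eventually_elim) (auto simp: indicator_def)
    then show ?thesis by (simp add: emeasure_inv_measure[OF A])
  next
    assume "emeasure lborel (Om - A) = 0"
    then have "Om - A \<in> null_sets lborel" by (simp add: null_sets_def)
    from AE_not_in[OF this]
    have "(\<integral>\<^sup>+x. indicator A x * ennreal (inv_dens x) * indicator Om x \<partial>lborel) = Z"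
      by (intro nn_integral_cong_AE, eventually_elim) (auto simp: indicator_def)
    then have "emeasure inv_measure A = Z / Z" by (simp only: emeasure_inv_measure[OF A])
    also have "\<dots> = 1" using Z by (simp add: ennreal_divide_self less_top)
    finally show ?thesis by simp
  qed
  then show "measure inv_measure A = 0 \<or> measure inv_measure A = 1" by (auto simp: measure_def)
qed

lemma ergodic_acim_inv_measure: "ergodic_acim a1 a2 N inv_measure"
  unfolding ergodic_acim_def
proof (intro conjI sets_inv_measure prob_space_inv_measure invariant_inv_measure ergodic_inv_measure)
  show "absolutely_continuous (restrict_space lborel (Omega a1 a2)) inv_measure"
    unfolding inv_measure_def
    by (intro absolutely_continuousI_density measurable_restrict_space1) auto
qed

text \<open>The density is positive on all of Omega, so Lebesgue measure there is absolutely
  continuous with respect to \<open>inv_measure\<close>. Any competing measure is therefore too, as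
  the uniqueness lemma requires.\<close>

lemma null_sets_inv_measure: "null_sets inv_measure \<subseteq> null_sets (restrict_space lborel (Omega a1 a2))"
proof
  fix A assume "A \<in> null_sets inv_measure"
  then have A: "A \<in> sets (restrict_space lborel (Omega a1 a2))"
    and AE: "AE x in restrict_space lborel (Omega a1 a2). x \<in> A \<longrightarrow> ennreal (inv_dens x) / Z = 0"
    unfolding inv_measure_def by (subst (asm) null_sets_density_iff; auto intro: measurable_restrict_space1)+
  have "AE x in restrict_space lborel (Omega a1 a2). x \<notin> A"
    using AE AE_space
  proof eventually_elim
    case (elim x)
    then have "0 < inv_dens x" by (intro inv_dens_pos) (simp add: space_restrict_space)
    then show ?case using elim Z by (auto simp: ennreal_divide_eq_0_iff ennreal_eq_0_iff)
  qed
  then show "A \<in> null_sets (restrict_space lborel (Omega a1 a2))"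
    using A by (simp add: AE_iff_null_sets)
qed

section \<open>Uniqueness and the explicit formula\<close>

lemma ergodic_acim_unique:
  assumes "ergodic_acim a1 a2 N \<mu>"
  shows "\<mu> = inv_measure"
proof (rule ergodic_absolutely_continuous_unique[OF prob_space_inv_measure invariant_inv_measure ergodic_inv_measure])
  show "absolutely_continuous inv_measure \<mu>"
    using assms null_sets_inv_measure by (auto simp: ergodic_acim_def absolutely_continuous_def)
qed (use assms in \<open>auto simp: ergodic_acim_def sets_inv_measure\<close>)

lemma measure_inv_measure:
  assumes "A \<in> sets (borel_Omega a1 a2)"
  shows "measure inv_measure A = (LINT x:A|lborel. inv_dens x) / enn2real Z"
proof -
  have [measurable]: "A \<in> sets borel" and sub: "A \<subseteq> Omega a1 a2"
    using assms by (auto simp: sets_borel_Omega)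
  have "(LINT x:A|lborel. inv_dens x) = enn2real (\<integral>\<^sup>+x. ennreal (indicator A x *\<^sub>R inv_dens x) \<partial>lborel)"
    unfolding set_lebesgue_integral_def
    by (rule integral_eq_nn_integral) (auto simp: inv_dens_nonneg)
  also have "(\<integral>\<^sup>+x. ennreal (indicator A x *\<^sub>R inv_dens x) \<partial>lborel)
      = (\<integral>\<^sup>+x. indicator A x * ennreal (inv_dens x) * indicator Om x \<partial>lborel)"
    using AE_Om by (intro nn_integral_cong_AE, eventually_elim) (use sub in \<open>auto simp: indicator_def\<close>)
  moreover have "enn2real (inverse Z) = inverse (enn2real Z)"
    using normalizer_pos by (simp add: nn_integral_inv_dens inverse_ennreal)
  ultimately show ?thesis
    using emeasure_inv_measure[OF assms]
    by (simp add: measure_def divide_ennreal_def enn2real_mult divide_inverse)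
qed

end

theorem corollary4p2:
  fixes a1 a2 N :: nat and C :: real
  assumes "a1 \<noteq> a2"
    and "simple_for a1 a2 N"
    and "inverse C = 2 * ln (1 + real N /
           ((real N + real a1 * (real a2 + 1)) * (real N + real a2 * (real a1 + 1))))"
  shows "(\<exists>!\<mu>. ergodic_acim a1 a2 N \<mu>) \<and>
    (\<forall>A\<in>sets (borel_Omega a1 a2).
       measure (mu_T a1 a2 N) A =
       C * (LINT x:A|lborel.
              ((real a2 + 1) / (real N + (real a2 + 1) * x) - real a2 / (real N + real a2 * x))
                * indicator (unit_interval_at a1) x
            + ((real a1 + 1) / (real N + (real a1 + 1) * x) - real a1 / (real N + real a1 * x))
                * indicator (unit_interval_at a2) x))"
proof -
  interpret simple_pair a1 a2 N by unfold_locales (use assms in auto)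
  have ex1: "\<exists>!\<mu>. ergodic_acim a1 a2 N \<mu>"
    using ergodic_acim_inv_measure ergodic_acim_unique by blast
  have mu: "mu_T a1 a2 N = inv_measure"
    unfolding mu_T_def by (rule the_equality) (auto intro: ergodic_acim_inv_measure ergodic_acim_unique)
  have "enn2real Z = inverse C"
    using normalizer_pos by (simp add: nn_integral_inv_dens assms(3))
  then have "measure (mu_T a1 a2 N) A = C * (LINT x:A|lborel. inv_dens x)"
    if "A \<in> sets (borel_Omega a1 a2)" for A
    by (simp add: mu measure_inv_measure[OF that] divide_inverse mult.commute)
  with ex1 show ?thesis unfolding inv_dens_def dens_def by blast
qed

end
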